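(* Let $K$ be a commutative ring and let $B=(B,\Delta^B,\varepsilon^B,S^B)$ and $C=(C,\Delta^C,\varepsilon^C,S^C)$ be Hopf algebras over $K$. Let $R\in C\otimes B$ be an invertible element such that $$(\Delta^C\otimes \mathrm{id})R=R_{23}R_{13},\qquad (\mathrm{id}\otimes\Delta^B)R=R_{12}R_{13},$$ $$(\mathrm{id}\otimes S^B)R=R^{-1},\qquad (S^C\otimes \mathrm{id})R=R^{-1}.$$ Suppose moreover that $B$ and $C$ are quasi-triangular with invertible structure elements $R^B\in B\otimes B$ and $R^C\in C\otimes C$, i.e. $$(\Delta^B)^{op}=R^B\,\Delta^B\,(R^B)^{-1},\qquad (\Delta^C)^{op}=R^C\,\Delta^C\,(R^C)^{-1},$$ $$(\Delta^B\otimes \mathrm{id})R^B=R^B_{13}R^B_{23},\qquad (\mathrm{id}\otimes\Delta^B)R^B=R^B_{13}R^B_{12},$$ $$(\Delta^C\otimes \mathrm{id})R^C=R^C_{13}R^C_{23},\qquad (\mathrm{id}\otimes\Delta^C)R^C=R^C_{13}R^C_{12}.$$ Let $B\otimes C$ carry the Hopf algebra structure with the tensor product multiplication, comultiplication $\Delta(b\otimes c)=R_{23}\,\Delta^B_{13}(b)\,\Delta^C_{24}(c)\,R_{23}^{-1}$, antipode $S(b\otimes c)=R_{21}^{-1}(S^B(b)\otimes S^C(c))R_{21}$ and counit $\varepsilon(b\otimes c)=\varepsilon^B(b)\varepsilon^C(c)$. Then $B\otimes C$ is quasi-triangular with structure element $$\mathcal R=R_{41}\,R^B_{13}\,R^C_{24}\,R_{23}^{-1}\in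 (B\otimes C)\otimes(B\otimes C);$$ that is, $\mathcal R$ is invertible, $\Delta^{op}(x)=\mathcal R\,\Delta(x)\,\mathcal R^{-1}$ for all $x\in B\otimes C$, and $$(\Delta\otimes \mathrm{id})\mathcal R=\mathcal R_{13}\mathcal R_{23},\qquad (\mathrm{id}\otimes\Delta)\mathcal R=\mathcal R_{13}\mathcal R_{12},$$ where in the last line the indices refer to the three tensor factors of $(B\otimes C)^{\otimes 3}$.
   Context: Tensor products are over $K$. $\Delta^{op}$ denotes $\Delta$ followed by the flip of the two tensor factors. Leg notation: for an element $T$ of a tensor product of two algebras, $T_{ij}$ denotes the element of a larger tensor product obtained by placing the first component of $T$ in position $i$, the second in position $j$, and $1$ in all other positions. Thus $(\Delta^C\otimes\mathrm{id})R=R_{23}R_{13}$ is an identity in $C\otimes C\otimes B$, and $(\mathrm{id}\otimes\Delta^B)R=R_{12}R_{13}$ is an identity in $C\otimes B\otimes B$. In $(B\otimes C)\otimes(B\otimes C)$ the positions $1,2,3,4$ are occupied by $B,C,B,C$ respectively; so $R_{23}$ has its $C$-component in position 2 and its $B$-component in position 3, and $R_{41}$ has its $C$-component in position 4 and its $B$-component in position 1. $\Delta^B_{13}(b)$ is $\Delta^B(b)$ placed in positions 1 and 3, and $\Delta^C_{24}(c)$ is $\Delta^C(c)$ placed in positions 2 and 4. In the formula for the antipode, $R_{21}\in B\otimes C$ is the flip of $R\in C\otimes B$. It is a known fact that, under the stated conditions on $R$, the given operations make $B\otimes C$ a Hopf algebra. *)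

theory Defs
  imports "HOL-Algebra.Algebra" "HOL-Algebra.Free_Abelian_Groups"
begin

text \<open>The library locale for algebras requires a commutative multiplication; this is its
  noncommutative version, hence the second compatibility axiom. The base ring is commutative.\<close>

locale nc_algebra = module + ring M +
  assumes smult_mult_l: "\<lbrakk>a \<in> carrier R; x \<in> carrier M; y \<in> carrier M\<rbrakk> \<Longrightarrow>
      (a \<odot>\<^bsub>M\<^esub> x) \<otimes>\<^bsub>M\<^esub> y = a \<odot>\<^bsub>M\<^esub> (x \<otimes>\<^bsub>M\<^esub> y)"
    and smult_mult_r: "\<lbrakk>a \<in> carrier R; x \<in> carrier M; y \<in> carrier M\<rbrakk> \<Longrightarrow>
      x \<otimes>\<^bsub>M\<^esub> (a \<odot>\<^bsub>M\<^esub> y) = a \<odot>\<^bsub>M\<^esub> (x \<otimes>\<^bsub>M\<^esub> y)"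

definition linear_maps ::
  "('k, 'r) ring_scheme \<Rightarrow> ('k, 'a, 'm) module_scheme \<Rightarrow> ('k, 'b, 'n) module_scheme \<Rightarrow> ('a \<Rightarrow> 'b) set"
  where "linear_maps K A B = {f \<in> carrier A \<rightarrow> carrier B.
     (\<forall>x\<in>carrier A. \<forall>y\<in>carrier A. f (x \<oplus>\<^bsub>A\<^esub> y) = f x \<oplus>\<^bsub>B\<^esub> f y) \<and>
     (\<forall>r\<in>carrier K. \<forall>x\<in>carrier A. f (r \<odot>\<^bsub>A\<^esub> x) = r \<odot>\<^bsub>B\<^esub> f x)}"

section \<open>Tensor products over \<open>K\<close>\<close>

text \<open>The tensor product of \<open>A\<close> and \<open>B\<close> over \<open>K\<close> is the free abelian group on
  \<open>carrier A \<times> carrier B\<close> modulo the subgroup generated by the relations of biadditivity and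
  \<open>K\<close>-balancedness. Its elements are cosets of that subgroup.\<close>

definition tensor_rels ::
  "('k, 'r) ring_scheme \<Rightarrow> ('k, 'a, 'm) module_scheme \<Rightarrow> ('k, 'b, 'n) module_scheme \<Rightarrow>
     ('a \<times> 'b \<Rightarrow>\<^sub>0 int) set"
  where "tensor_rels K A B =
     {frag_of (a \<oplus>\<^bsub>A\<^esub> a', b) - frag_of (a, b) - frag_of (a', b) | a a' b.
        a \<in> carrier A \<and> a' \<in> carrier A \<and> b \<in> carrier B}
   \<union> {frag_of (a, b \<oplus>\<^bsub>B\<^esub> b') - frag_of (a, b) - frag_of (a, b') | a b b'.
        a \<in> carrier A \<and> b \<in> carrier B \<and> b' \<in> carrier B}
   \<union> {frag_of (r \<odot>\<^bsub>A\<^esub> a, b) - frag_of (a, r \<odot>\<^bsub>B\<^esub> b) | r a b.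
        r \<in> carrier K \<and> a \<in> carrier A \<and> b \<in> carrier B}"

definition tensor_null ::
  "('k, 'r) ring_scheme \<Rightarrow> ('k, 'a, 'm) module_scheme \<Rightarrow> ('k, 'b, 'n) module_scheme \<Rightarrow>
     ('a \<times> 'b \<Rightarrow>\<^sub>0 int) set"
  where "tensor_null K A B =
     generate (free_Abelian_group (carrier A \<times> carrier B)) (tensor_rels K A B)"

definition tensor_group ::
  "('k, 'r) ring_scheme \<Rightarrow> ('k, 'a, 'm) module_scheme \<Rightarrow> ('k, 'b, 'n) module_scheme \<Rightarrow>
     ('a \<times> 'b \<Rightarrow>\<^sub>0 int) set monoid"
  where "tensor_group K A B =
     free_Abelian_group (carrier A \<times> carrier B) Mod tensor_null K A B"

definition pure ::
  "('k, 'r) ring_scheme \<Rightarrow> ('k, 'a, 'm) module_scheme \<Rightarrow> ('k, 'b, 'n) module_scheme \<Rightarrow>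
     'a \<Rightarrow> 'b \<Rightarrow> ('a \<times> 'b \<Rightarrow>\<^sub>0 int) set"
  where "pure K A B a b =
     tensor_null K A B #>\<^bsub>free_Abelian_group (carrier A \<times> carrier B)\<^esub> frag_of (a, b)"

text \<open>The homomorphism into an abelian group \<open>G\<close> (written multiplicatively) that takes the value
  \<open>f a b\<close> at the pure tensor of \<open>a\<close> and \<open>b\<close>. It is meaningful if \<open>f\<close> is biadditive and
  \<open>K\<close>-balanced: then the product below is the same for all representatives of the coset \<open>t\<close>.\<close>

definition tensor_ext ::
  "('k, 'r) ring_scheme \<Rightarrow> ('k, 'a, 'm) module_scheme \<Rightarrow> ('k, 'b, 'n) module_scheme \<Rightarrow>
     ('c, 'l) monoid_scheme \<Rightarrow> ('a \<Rightarrow> 'b \<Rightarrow> 'c) \<Rightarrow> ('a \<times> 'b \<Rightarrow>\<^sub>0 int) set \<Rightarrow> 'c"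
  where "tensor_ext K A B G f t =
     the_elem ((\<lambda>x. \<Otimes>\<^bsub>G\<^esub>p\<in>Poly_Mapping.keys x.
        f (fst p) (snd p) [^]\<^bsub>G\<^esub> Poly_Mapping.lookup x p) ` t)"

definition tensor ::
  "('k, 'r) ring_scheme \<Rightarrow> ('k, 'a, 'm) module_scheme \<Rightarrow> ('k, 'b, 'n) module_scheme \<Rightarrow>
     ('k, ('a \<times> 'b \<Rightarrow>\<^sub>0 int) set) module"
  where "tensor K A B =
    \<lparr>carrier = carrier (tensor_group K A B),
     monoid.mult = (\<lambda>s t. tensor_ext K A B (tensor_group K A B)
       (\<lambda>a b. tensor_ext K A B (tensor_group K A B)
          (\<lambda>a' b'. pure K A B (a \<otimes>\<^bsub>A\<^esub> a') (b \<otimes>\<^bsub>B\<^esub> b')) t) s),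
     one = pure K A B \<one>\<^bsub>A\<^esub> \<one>\<^bsub>B\<^esub>,
     ring.zero = \<one>\<^bsub>tensor_group K A B\<^esub>,
     add = monoid.mult (tensor_group K A B),
     smult = (\<lambda>r. tensor_ext K A B (tensor_group K A B) (\<lambda>a b. pure K A B (r \<odot>\<^bsub>A\<^esub> a) b))\<rparr>"

definition tensor_lift ::
  "('k, 'r) ring_scheme \<Rightarrow> ('k, 'a, 'm) module_scheme \<Rightarrow> ('k, 'b, 'n) module_scheme \<Rightarrow>
     ('c, 'l) ring_scheme \<Rightarrow> ('a \<Rightarrow> 'b \<Rightarrow> 'c) \<Rightarrow> ('a \<times> 'b \<Rightarrow>\<^sub>0 int) set \<Rightarrow> 'c"
  where "tensor_lift K A B D f = tensor_ext K A B (add_monoid D) f"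

definition tensor_map ::
  "('k, 'r) ring_scheme \<Rightarrow> ('k, 'a, 'm) module_scheme \<Rightarrow> ('k, 'b, 'n) module_scheme \<Rightarrow>
     ('k, 'c, 'p) module_scheme \<Rightarrow> ('k, 'd, 'q) module_scheme \<Rightarrow> ('a \<Rightarrow> 'c) \<Rightarrow> ('b \<Rightarrow> 'd) \<Rightarrow>
     ('a \<times> 'b \<Rightarrow>\<^sub>0 int) set \<Rightarrow> ('c \<times> 'd \<Rightarrow>\<^sub>0 int) set"
  where "tensor_map K A B A' B' f g =
     tensor_lift K A B (tensor K A' B') (\<lambda>a b. pure K A' B' (f a) (g b))"

definition tensor_flip ::
  "('k, 'r) ring_scheme \<Rightarrow> ('k, 'a, 'm) module_scheme \<Rightarrow> ('k, 'b, 'n) module_scheme \<Rightarrow>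
     ('a \<times> 'b \<Rightarrow>\<^sub>0 int) set \<Rightarrow> ('b \<times> 'a \<Rightarrow>\<^sub>0 int) set"
  where "tensor_flip K A B = tensor_lift K A B (tensor K B A) (\<lambda>a b. pure K B A b a)"

text \<open>Threefold tensor products are bracketed to the right; the elements obtained by applying a
  comultiplication to the first factor are moved there by the associativity isomorphism.\<close>

abbreviation tensor3 where
  "tensor3 K A B C \<equiv> tensor K A (tensor K B C)"

abbreviation pure3 where
  "pure3 K A B C a b c \<equiv> pure K A (tensor K B C) a (pure K B C b c)"

definition tensor_assoc ::
  "('k, 'r) ring_scheme \<Rightarrow> ('k, 'a, 'm) module_scheme \<Rightarrow> ('k, 'b, 'n) module_scheme \<Rightarrow>
     ('k, 'c, 'p) module_scheme \<Rightarrow> (('a \<times> 'b \<Rightarrow>\<^sub>0 int) set \<times> 'c \<Rightarrow>\<^sub>0 int) set \<Rightarrow>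
     ('a \<times> ('b \<times> 'c \<Rightarrow>\<^sub>0 int) set \<Rightarrow>\<^sub>0 int) set"
  where "tensor_assoc K A B C =
     tensor_lift K (tensor K A B) C (tensor3 K A B C)
       (\<lambda>x c. tensor_lift K A B (tensor3 K A B C) (\<lambda>a b. pure3 K A B C a b c) x)"

section \<open>Leg notation\<close>

text \<open>\<open>leg\<^sub>i\<^sub>j K A\<^sub>1 A\<^sub>2 A\<^sub>3 T\<close> is \<open>T\<^sub>i\<^sub>j\<close> in the tensor product of \<open>A\<^sub>1\<close>, \<open>A\<^sub>2\<close>, \<open>A\<^sub>3\<close>.\<close>

definition leg12 where
  "leg12 K A B C = tensor_lift K A B (tensor3 K A B C) (\<lambda>a b. pure3 K A B C a b \<one>\<^bsub>C\<^esub>)"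

definition leg13 where
  "leg13 K A B C = tensor_lift K A C (tensor3 K A B C) (\<lambda>a c. pure3 K A B C a \<one>\<^bsub>B\<^esub> c)"

definition leg23 where
  "leg23 K A B C = tensor_lift K B C (tensor3 K A B C) (\<lambda>b c. pure3 K A B C \<one>\<^bsub>A\<^esub> b c)"

text \<open>The fourfold tensor product with factors \<open>B\<close>, \<open>C\<close>, \<open>B\<close>, \<open>C\<close> in positions 1, 2, 3, 4.
  The letters and digits of the leg maps below name the factors of the argument and, in the same order,
  their positions: \<open>cb41\<close> puts the \<open>C\<close>-component in position 4 and the \<open>B\<close>-component in position 1.\<close>

abbreviation tensor_BCBC where
  "tensor_BCBC K B C \<equiv> tensor K (tensor K B C) (tensor K B C)"

abbreviation pure_BCBC where
  "pure_BCBC K B C b c b' c' \<equiv>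
     pure K (tensor K B C) (tensor K B C) (pure K B C b c) (pure K B C b' c')"

definition bb13 where
  "bb13 K B C = tensor_lift K B B (tensor_BCBC K B C)
     (\<lambda>b b'. pure_BCBC K B C b \<one>\<^bsub>C\<^esub> b' \<one>\<^bsub>C\<^esub>)"

definition cc24 where
  "cc24 K B C = tensor_lift K C C (tensor_BCBC K B C)
     (\<lambda>c c'. pure_BCBC K B C \<one>\<^bsub>B\<^esub> c \<one>\<^bsub>B\<^esub> c')"

definition cb23 where
  "cb23 K B C = tensor_lift K C B (tensor_BCBC K B C)
     (\<lambda>c b. pure_BCBC K B C \<one>\<^bsub>B\<^esub> c b \<one>\<^bsub>C\<^esub>)"

definition cb41 where
  "cb41 K B C = tensor_lift K C B (tensor_BCBC K B C)
     (\<lambda>c b. pure_BCBC K B C b \<one>\<^bsub>C\<^esub> \<one>\<^bsub>B\<^esub> c)"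

section \<open>Hopf algebras\<close>

record ('k, 'a) hopf = "('k, 'a) module" +
  comult :: "'a \<Rightarrow> ('a \<times> 'a \<Rightarrow>\<^sub>0 int) set"
  counit :: "'a \<Rightarrow> 'k"
  antipode :: "'a \<Rightarrow> 'a"

locale hopf_algebra = nc_algebra K H
  for K :: "('k, 'r) ring_scheme" and H :: "('k, 'a) hopf" +
  assumes comult_ring_hom: "comult H \<in> ring_hom H (tensor K H H)"
    and comult_linear: "comult H \<in> linear_maps K H (tensor K H H)"
    and counit_ring_hom: "counit H \<in> ring_hom H K"
    and counit_linear: "\<lbrakk>r \<in> carrier K; x \<in> carrier H\<rbrakk> \<Longrightarrow>
      counit H (r \<odot>\<^bsub>H\<^esub> x) = r \<otimes>\<^bsub>K\<^esub> counit H x"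
    and antipode_linear: "antipode H \<in> linear_maps K H H"
    and coassoc: "x \<in> carrier H \<Longrightarrow>
      tensor_assoc K H H H (tensor_map K H H (tensor K H H) H (comult H) (\<lambda>y. y) (comult H x)) =
      tensor_map K H H H (tensor K H H) (\<lambda>y. y) (comult H) (comult H x)"
    and counit_left: "x \<in> carrier H \<Longrightarrow>
      tensor_lift K H H H (\<lambda>y z. counit H y \<odot>\<^bsub>H\<^esub> z) (comult H x) = x"
    and counit_right: "x \<in> carrier H \<Longrightarrow>
      tensor_lift K H H H (\<lambda>y z. counit H z \<odot>\<^bsub>H\<^esub> y) (comult H x) = x"
    and antipode_left: "x \<in> carrier H \<Longrightarrow>
      tensor_lift K H H H (\<lambda>y z. antipode H y \<otimes>\<^bsub>H\<^esub> z) (comult H x) = counit H x \<odot>\<^bsub>H\<^esub> \<one>\<^bsub>H\<^esub>"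
    and antipode_right: "x \<in> carrier H \<Longrightarrow>
      tensor_lift K H H H (\<lambda>y z. y \<otimes>\<^bsub>H\<^esub> antipode H z) (comult H x) = counit H x \<odot>\<^bsub>H\<^esub> \<one>\<^bsub>H\<^esub>"

text \<open>The Hopf algebra axioms for \<open>H\<close> are not part of the following predicate.\<close>

definition quasi_triangular ::
  "('k, 'r) ring_scheme \<Rightarrow> ('k, 'a) hopf \<Rightarrow> ('a \<times> 'a \<Rightarrow>\<^sub>0 int) set \<Rightarrow> bool"
  where "quasi_triangular K H T \<longleftrightarrow>
     T \<in> Units (tensor K H H) \<and>
     (\<forall>x\<in>carrier H. tensor_flip K H H (comult H x) =
        T \<otimes>\<^bsub>tensor K H H\<^esub> comult H x \<otimes>\<^bsub>tensor K H H\<^esub> inv\<^bsub>tensor K H H\<^esub> T) \<and>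
     tensor_assoc K H H H (tensor_map K H H (tensor K H H) H (comult H) (\<lambda>y. y) T) =
        leg13 K H H H T \<otimes>\<^bsub>tensor3 K H H H\<^esub> leg23 K H H H T \<and>
     tensor_map K H H H (tensor K H H) (\<lambda>y. y) (comult H) T =
        leg13 K H H H T \<otimes>\<^bsub>tensor3 K H H H\<^esub> leg12 K H H H T"

text \<open>The Hopf algebra structure on the tensor product of \<open>B\<close> and \<open>C\<close> determined by an invertible
  element \<open>R\<close> of the tensor product of \<open>C\<close> and \<open>B\<close>.\<close>

definition twisted_product ::
  "('k, 'r) ring_scheme \<Rightarrow> ('k, 'b) hopf \<Rightarrow> ('k, 'c) hopf \<Rightarrow> ('c \<times> 'b \<Rightarrow>\<^sub>0 int) set \<Rightarrow>
     ('k, ('b \<times> 'c \<Rightarrow>\<^sub>0 int) set) hopf"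
  where "twisted_product K B C R =
     module.extend (tensor K B C) (hopf.fields
       (tensor_lift K B C (tensor_BCBC K B C) (\<lambda>b c.
          cb23 K B C R \<otimes>\<^bsub>tensor_BCBC K B C\<^esub> bb13 K B C (comult B b)
            \<otimes>\<^bsub>tensor_BCBC K B C\<^esub> cc24 K B C (comult C c)
            \<otimes>\<^bsub>tensor_BCBC K B C\<^esub> inv\<^bsub>tensor_BCBC K B C\<^esub> (cb23 K B C R)))
       (tensor_lift K B C K (\<lambda>b c. counit B b \<otimes>\<^bsub>K\<^esub> counit C c))
       (tensor_lift K B C (tensor K B C) (\<lambda>b c.
          inv\<^bsub>tensor K B C\<^esub> (tensor_flip K C B R)
            \<otimes>\<^bsub>tensor K B C\<^esub> pure K B C (antipode B b) (antipode C c)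
            \<otimes>\<^bsub>tensor K B C\<^esub> tensor_flip K C B R)))"

end

theory Submission
  imports Defs
begin

text \<open>Before twisting, \<open>B \<otimes> C\<close> has the comultiplication \<open>\<Delta>\<^sub>0(b \<otimes> c) = \<Delta>\<^sup>B\<^sub>1\<^sub>3(b) \<Delta>\<^sup>C\<^sub>2\<^sub>4(c)\<close> and the structure
element \<open>R\<^sup>B\<^sub>1\<^sub>3 R\<^sup>C\<^sub>2\<^sub>4\<close>. The comultiplication of the theorem is \<open>\<Delta> = F \<Delta>\<^sub>0 F\<inverse>\<close> with \<open>F = R\<^sub>2\<^sub>3\<close>, and
the asserted structure element is \<open>F' R\<^sup>B\<^sub>1\<^sub>3 R\<^sup>C\<^sub>2\<^sub>4 F\<inverse>\<close>, where \<open>F' = R\<^sub>4\<^sub>1\<close> is \<open>F\<close> with the two copies of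
\<open>B \<otimes> C\<close> exchanged. Hence it is invertible and conjugates \<open>\<Delta>\<close> to \<open>\<Delta>\<^sup>o\<^sup>p\<close>.

For the other two conditions write, in the tensor product of three copies of \<open>B \<otimes> C\<close>, \<open>r i j\<close> for
\<open>R\<close> with its \<open>C\<close>-component in copy \<open>i\<close> and its \<open>B\<close>-component in copy \<open>j\<close>, and \<open>p i j\<close>, \<open>q i j\<close>
for \<open>R\<^sup>B\<close>, \<open>R\<^sup>C\<close> in copies \<open>i\<close> and \<open>j\<close>. The structure element in copies \<open>i\<close>, \<open>j\<close> is then
\<open>t i j = r j i \<cdot> p i j \<cdot> q i j \<cdot> (r i j)\<inverse>\<close>. Since \<open>\<Delta>\<close> is a homomorphism, the hypotheses on \<open>R\<close>,
\<open>R\<^sup>B\<close>, \<open>R\<^sup>C\<close> give for \<open>(\<Delta> \<otimes> id)\<close> of the structure element the conjugate by \<open>r 1 2\<close> of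
\<open>(r 3 1 \<cdot> r 3 2) (p 1 3 \<cdot> p 2 3) (q 1 3 \<cdot> q 2 3) (r 2 3 \<cdot> r 1 3)\<inverse>\<close>,
and this has to be \<open>t 1 3 \<cdot> t 2 3\<close>. Most of the factors commute, because they sit in
different tensor factors. Two exchanges remain, and they are the relations of Yang-Baxter type
\<open>q 1 3 \<cdot> r 3 2 \<cdot> r 1 2 = r 1 2 \<cdot> r 3 2 \<cdot> q 1 3\<close> and \<open>p 2 3 \<cdot> r 1 2 \<cdot> r 1 3 = r 1 3 \<cdot> r 1 2 \<cdot> p 2 3\<close>:
in the first one both products of \<open>r\<close> are the images of \<open>R\<close> under \<open>\<Delta>\<^sup>C \<otimes> id\<close> and
\<open>(\<Delta>\<^sup>C)\<^sup>o\<^sup>p \<otimes> id\<close>, which \<open>R\<^sup>C\<close> conjugates into each other, and similarly for \<open>\<Delta>\<^sup>B\<close> and \<open>R\<^sup>B\<close> in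
the second one (\<open>yang_baxter_C\<close>, \<open>yang_baxter_B\<close>). The condition on \<open>(id \<otimes> \<Delta>)\<close> is the same
computation with the roles of \<open>p\<close> and \<open>q\<close> exchanged, so both are instances of one identity in a monoid
(\<open>conjugate_regroup\<close>).

To make this a computation in a single ring, the tensor product is used only through its universal
property: two algebra homomorphisms \<open>A \<rightarrow> D\<close>, \<open>B \<rightarrow> D\<close> with commuting images induce one from
\<open>A \<otimes> B\<close> (\<open>copair\<close>), which is determined by its values at \<open>a \<otimes> 1\<close> and \<open>1 \<otimes> b\<close> (\<open>hom_eqI\<close>).
All leg maps, the associativity isomorphism, the flip and the maps \<open>\<Delta> \<otimes> id\<close>, \<open>id \<otimes> \<Delta>\<close> are of this
form. The hypotheses therefore hold in every algebra \<open>D\<close> that contains commuting images of the factors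
(\<open>copair3_map_left\<close>, \<open>copair3_map_right\<close>), and the computation can be made for such a \<open>D\<close> in place of
an iterated tensor product with its bracketing.\<close>

section \<open>The universal property of the tensor product\<close>

text \<open>The extension of \<open>f\<close> to formal integer combinations, in the form in which \<open>tensor_ext\<close> applies it to
the representatives of a coset.\<close>

definition frag_prod :: "('g, 'l) monoid_scheme \<Rightarrow> ('p \<Rightarrow> 'g) \<Rightarrow> ('p \<Rightarrow>\<^sub>0 int) \<Rightarrow> 'g"
  where "frag_prod G f x =
    (\<Otimes>\<^bsub>G\<^esub>p\<in>Poly_Mapping.keys x. f p [^]\<^bsub>G\<^esub> Poly_Mapping.lookup x p)"

lemma (in comm_group) frag_prod_superset:
  assumes "f \<in> I \<rightarrow> carrier G" "finite I" "Poly_Mapping.keys x \<subseteq> I"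
  shows "frag_prod G f x = (\<Otimes>p\<in>I. f p [^] Poly_Mapping.lookup x p)"
  unfolding frag_prod_def
proof (rule finprod_mono_neutral_cong_left)
  show "\<And>p. p \<in> I - Poly_Mapping.keys x \<Longrightarrow> f p [^] Poly_Mapping.lookup x p = \<one>"
    by (simp add: in_keys_iff)
qed (use assms in \<open>auto simp: Pi_iff\<close>)

lemma (in comm_group) frag_prod_hom:
  assumes "f \<in> S \<rightarrow> carrier G"
  shows "frag_prod G f \<in> hom (free_Abelian_group S) G"
proof (rule homI)
  fix x y
  assume "x \<in> carrier (free_Abelian_group S)" "y \<in> carrier (free_Abelian_group S)"
  then have keys: "Poly_Mapping.keys x \<subseteq> S" "Poly_Mapping.keys y \<subseteq> S" by simp_all
  define I where "I = Poly_Mapping.keys x \<union> Poly_Mapping.keys y"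
  have I: "f \<in> I \<rightarrow> carrier G" "finite I" "Poly_Mapping.keys x \<subseteq> I" "Poly_Mapping.keys y \<subseteq> I"
    "Poly_Mapping.keys (x + y) \<subseteq> I"
    using assms keys keys_add[of x y] by (auto simp: I_def)
  have "frag_prod G f (x + y) =
      (\<Otimes>p\<in>I. f p [^] Poly_Mapping.lookup x p \<otimes> f p [^] Poly_Mapping.lookup y p)"
    unfolding frag_prod_superset[OF I(1,2,5)]
    by (rule finprod_cong') (use I(1) in \<open>auto simp: lookup_add int_pow_mult Pi_iff\<close>)
  also have "\<dots> = frag_prod G f x \<otimes> frag_prod G f y"
    using I by (simp add: frag_prod_superset) (rule finprod_multf, auto)
  finally show "frag_prod G f (x \<otimes>\<^bsub>free_Abelian_group S\<^esub> y) = frag_prod G f x \<otimes> frag_prod G f y"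
    by simp
next
  fix x assume "x \<in> carrier (free_Abelian_group S)"
  then show "frag_prod G f x \<in> carrier G"
    unfolding frag_prod_def using assms by (intro finprod_closed) auto
qed

lemma (in comm_group) frag_prod_frag_of:
  assumes "f p \<in> carrier G"
  shows "frag_prod G f (frag_of p) = f p"
proof -
  have "(\<lambda>q. f q [^] Poly_Mapping.lookup (frag_of p) q) \<in> {p} \<rightarrow> carrier G"
    using assms by auto
  then show ?thesis using assms by (simp add: frag_prod_def finprod_singleton keys_frag_of)
qed

definition balanced ::
  "('k, 'r) ring_scheme \<Rightarrow> ('k, 'a, 'm) module_scheme \<Rightarrow> ('k, 'b, 'n) module_scheme \<Rightarrow>
     ('c, 'l) ring_scheme \<Rightarrow> ('a \<Rightarrow> 'b \<Rightarrow> 'c) \<Rightarrow> bool"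
  where "balanced K A B D f \<longleftrightarrow>
    (\<forall>a\<in>carrier A. \<forall>b\<in>carrier B. f a b \<in> carrier D) \<and>
    (\<forall>a\<in>carrier A. \<forall>a'\<in>carrier A. \<forall>b\<in>carrier B. f (a \<oplus>\<^bsub>A\<^esub> a') b = f a b \<oplus>\<^bsub>D\<^esub> f a' b) \<and>
    (\<forall>a\<in>carrier A. \<forall>b\<in>carrier B. \<forall>b'\<in>carrier B. f a (b \<oplus>\<^bsub>B\<^esub> b') = f a b \<oplus>\<^bsub>D\<^esub> f a b') \<and>
    (\<forall>r\<in>carrier K. \<forall>a\<in>carrier A. \<forall>b\<in>carrier B. f (r \<odot>\<^bsub>A\<^esub> a) b = f a (r \<odot>\<^bsub>B\<^esub> b))"

text \<open>The algebra structure of \<open>tensor K A B\<close> is defined through the bare group \<open>tensor_group K A B\<close>,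
which differs only in the type of the record from the additive group of \<open>tensor K A B\<close>. So all
operations are instances of \<open>tensor_lift\<close>, and one universal property covers them.\<close>

lemma tensor_ext_tensor_group:
  "tensor_ext K A B (tensor_group K A' B') f = tensor_lift K A B (tensor K A' B') f"
  unfolding tensor_lift_def tensor_ext_def finprod_def int_pow_def nat_pow_def m_inv_def Let_def
  by (simp add: tensor_def cong: if_cong)

lemma tensor_mult_lift:
  "s \<otimes>\<^bsub>tensor K A B\<^esub> t = tensor_lift K A B (tensor K A B)
     (\<lambda>a b. tensor_lift K A B (tensor K A B)
        (\<lambda>a' b'. pure K A B (a \<otimes>\<^bsub>A\<^esub> a') (b \<otimes>\<^bsub>B\<^esub> b')) t) s"
  unfolding tensor_ext_tensor_group[symmetric] by (simp add: tensor_def)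

lemma tensor_smult_lift:
  "r \<odot>\<^bsub>tensor K A B\<^esub> t =
     tensor_lift K A B (tensor K A B) (\<lambda>a b. pure K A B (r \<odot>\<^bsub>A\<^esub> a) b) t"
  unfolding tensor_ext_tensor_group[symmetric] by (simp add: tensor_def)

lemma tensor_one: "\<one>\<^bsub>tensor K A B\<^esub> = pure K A B \<one>\<^bsub>A\<^esub> \<one>\<^bsub>B\<^esub>"
  by (simp add: tensor_def)

locale tensor_pair =
  fixes K :: "('k, 'r) ring_scheme" and A :: "('k, 'a, 'm) module_scheme"
    and B :: "('k, 'b, 'n) module_scheme"
  assumes left_module: "module K A" and right_module: "module K B"
begin

interpretation A: module K A by (rule left_module)
interpretation B: module K B by (rule right_module)

abbreviation "F \<equiv> free_Abelian_group (carrier A \<times> carrier B)"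

lemma frag_diff_closed: "\<lbrakk>x \<in> carrier F; y \<in> carrier F\<rbrakk> \<Longrightarrow> x - y \<in> carrier F"
  using keys_diff[of x y] by auto

lemma frag_add_closed: "\<lbrakk>x \<in> carrier F; y \<in> carrier F\<rbrakk> \<Longrightarrow> x + y \<in> carrier F"
  using keys_add[of x y] by auto

lemma tensor_rels_subset: "tensor_rels K A B \<subseteq> carrier F"
  unfolding tensor_rels_def Un_subset_iff
  by (intro conjI subsetI; elim CollectE exE conjE; hypsubst)
     (intro frag_diff_closed; simp)+

lemma null_normal: "tensor_null K A B \<lhd> F"
  unfolding tensor_null_def
  by (rule comm_group.subgroup_imp_normal[OF abelian_free_Abelian_group])
     (rule group.generate_is_subgroup[OF group_free_Abelian_group tensor_rels_subset])

lemma tensor_group_comm_group: "comm_group (tensor_group K A B)"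
  unfolding tensor_group_def
  by (rule comm_group.abelian_FactGroup[OF abelian_free_Abelian_group])
     (use null_normal in \<open>simp add: normal_def\<close>)

lemma tensor_abelian_group: "abelian_group (tensor K A B)"
proof -
  interpret G: comm_group "tensor_group K A B" by (rule tensor_group_comm_group)
  note [simp] = G.m_assoc G.m_comm G.m_lcomm
  show ?thesis
  proof (rule abelian_groupI)
    fix x assume "x \<in> carrier (tensor K A B)"
    then show "\<exists>y\<in>carrier (tensor K A B). y \<oplus>\<^bsub>tensor K A B\<^esub> x = \<zero>\<^bsub>tensor K A B\<^esub>"
      using G.l_inv_ex by (simp add: tensor_def)
  qed (simp_all add: tensor_def)
qed

interpretation T: abelian_group "tensor K A B" by (rule tensor_abelian_group)

lemma coset_add:
  assumes "x \<in> carrier F" "y \<in> carrier F"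
  shows "tensor_null K A B #>\<^bsub>F\<^esub> (x + y) =
    (tensor_null K A B #>\<^bsub>F\<^esub> x) \<oplus>\<^bsub>tensor K A B\<^esub> (tensor_null K A B #>\<^bsub>F\<^esub> y)"
  using normal.rcos_sum[OF null_normal, of x y] assms
  by (simp add: tensor_def tensor_group_def)

lemma coset_closed: "x \<in> carrier F \<Longrightarrow> tensor_null K A B #>\<^bsub>F\<^esub> x \<in> carrier (tensor K A B)"
  by (auto simp: tensor_def tensor_group_def carrier_FactGroup)

lemma pure_closed [simp, intro]:
  "\<lbrakk>a \<in> carrier A; b \<in> carrier B\<rbrakk> \<Longrightarrow> pure K A B a b \<in> carrier (tensor K A B)"
  unfolding pure_def by (rule coset_closed) simp

lemma coset_eq:
  assumes "x \<in> carrier F" "y \<in> carrier F" "x - y \<in> tensor_null K A B"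
  shows "tensor_null K A B #>\<^bsub>F\<^esub> x = tensor_null K A B #>\<^bsub>F\<^esub> y"
proof (rule group.repr_independence[OF group_free_Abelian_group])
  show "subgroup (tensor_null K A B) F" using null_normal by (simp add: normal_def)
  have "x = (x - y) \<otimes>\<^bsub>F\<^esub> y" by simp
  then have "x \<in> tensor_null K A B #>\<^bsub>F\<^esub> y"
    unfolding r_coset_def using assms(3) by blast
  then show "y \<in> tensor_null K A B #>\<^bsub>F\<^esub> x"
    using assms(1,2) \<open>subgroup (tensor_null K A B) F\<close>
    by (metis group.repr_independence group.rcos_self group_free_Abelian_group)
qed (use assms in auto)

lemma rels_null: "x \<in> tensor_rels K A B \<Longrightarrow> x \<in> tensor_null K A B"
  unfolding tensor_null_def by (rule generate.incl)

lemma pure_balanced: "balanced K A B (tensor K A B) (pure K A B)"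
proof -
  have sum: "pure K A B a b = pure K A B a1 b1 \<oplus>\<^bsub>tensor K A B\<^esub> pure K A B a2 b2"
    if "frag_of (a, b) - frag_of (a1, b1) - frag_of (a2, b2) \<in> tensor_rels K A B"
      and c: "a \<in> carrier A" "b \<in> carrier B" "a1 \<in> carrier A" "b1 \<in> carrier B"
        "a2 \<in> carrier A" "b2 \<in> carrier B" for a b a1 b1 a2 b2
  proof -
    have cc: "frag_of (a, b) \<in> carrier F" "frag_of (a1, b1) \<in> carrier F" "frag_of (a2, b2) \<in> carrier F"
      using c by auto
    then have ccc: "frag_of (a1, b1) + frag_of (a2, b2) \<in> carrier F"
      by (intro frag_add_closed)
    show ?thesis
      using coset_eq[OF cc(1) ccc] rels_null[OF that(1)]
      by (simp add: pure_def diff_diff_eq coset_add[OF cc(2,3)])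
  qed
  have eq: "pure K A B a b = pure K A B a1 b1"
    if "frag_of (a, b) - frag_of (a1, b1) \<in> tensor_rels K A B"
      and c: "a \<in> carrier A" "b \<in> carrier B" "a1 \<in> carrier A" "b1 \<in> carrier B" for a b a1 b1
    using coset_eq rels_null[OF that(1)] c by (simp add: pure_def)
  show ?thesis
    unfolding balanced_def
    by (intro conjI ballI pure_closed sum eq; (simp; fail)?)
       (unfold tensor_rels_def; blast)+
qed

lemma
  assumes "a \<in> carrier A" "b \<in> carrier B"
  shows pure_add_l: "a' \<in> carrier A \<Longrightarrow>
      pure K A B (a \<oplus>\<^bsub>A\<^esub> a') b = pure K A B a b \<oplus>\<^bsub>tensor K A B\<^esub> pure K A B a' b"
    and pure_add_r: "b' \<in> carrier B \<Longrightarrow>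
      pure K A B a (b \<oplus>\<^bsub>B\<^esub> b') = pure K A B a b \<oplus>\<^bsub>tensor K A B\<^esub> pure K A B a b'"
    and pure_smult: "r \<in> carrier K \<Longrightarrow> pure K A B (r \<odot>\<^bsub>A\<^esub> a) b = pure K A B a (r \<odot>\<^bsub>B\<^esub> b)"
  using pure_balanced assms by (simp_all add: balanced_def)

lemma tensor_carrierE:
  assumes "t \<in> carrier (tensor K A B)"
  obtains x where "x \<in> carrier F" "t = tensor_null K A B #>\<^bsub>F\<^esub> x"
  using assms by (auto simp: tensor_def tensor_group_def carrier_FactGroup)

text \<open>The negative of a pure tensor is pure, so pure tensors generate already under addition.\<close>

lemma tensor_induct [consumes 1, case_names pure add]:
  assumes "t \<in> carrier (tensor K A B)"
    and pure: "\<And>a b. \<lbrakk>a \<in> carrier A; b \<in> carrier B\<rbrakk> \<Longrightarrow> P (pure K A B a b)"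
    and add: "\<And>s t. \<lbrakk>s \<in> carrier (tensor K A B); t \<in> carrier (tensor K A B); P s; P t\<rbrakk> \<Longrightarrow>
      P (s \<oplus>\<^bsub>tensor K A B\<^esub> t)"
  shows "P t"
proof -
  let ?N = "tensor_null K A B"
  have pure_zero: "pure K A B \<zero>\<^bsub>A\<^esub> b = \<zero>\<^bsub>tensor K A B\<^esub>" if "b \<in> carrier B" for b
    using pure_add_l[of "\<zero>\<^bsub>A\<^esub>" b "\<zero>\<^bsub>A\<^esub>"] that by simp
  have neg: "\<ominus>\<^bsub>tensor K A B\<^esub> pure K A B a b = pure K A B (\<ominus>\<^bsub>A\<^esub> a) b"
    if "a \<in> carrier A" "b \<in> carrier B" for a b
    using pure_add_l[of "\<ominus>\<^bsub>A\<^esub> a" b a] that pure_zero[of b]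
    by (intro T.minus_equality) (simp_all add: A.M.l_neg)
  \<comment> \<open>The induction on the free abelian group passes through differences, so negatives are carried along.\<close>
  define Q where "Q x \<longleftrightarrow> P (?N #>\<^bsub>F\<^esub> x) \<and> P (\<ominus>\<^bsub>tensor K A B\<^esub> (?N #>\<^bsub>F\<^esub> x))" for x
  obtain x where x: "x \<in> carrier F" "t = ?N #>\<^bsub>F\<^esub> x" using assms(1) by (rule tensor_carrierE)
  have "Poly_Mapping.keys x \<subseteq> carrier A \<times> carrier B" using x by simp
  then have "Q x"
  proof (induction x rule: free_Abelian_group_induct[consumes 1, case_names zero diff of])
    case zero
    have "?N #>\<^bsub>F\<^esub> 0 = \<zero>\<^bsub>tensor K A B\<^esub>"
      using coset_add[of 0 0] coset_closed[of 0] by simp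
    moreover have "P \<zero>\<^bsub>tensor K A B\<^esub>"
      using pure[of "\<zero>\<^bsub>A\<^esub>" "\<zero>\<^bsub>B\<^esub>"] by (simp add: pure_zero)
    moreover have "\<ominus>\<^bsub>tensor K A B\<^esub> \<zero>\<^bsub>tensor K A B\<^esub> = \<zero>\<^bsub>tensor K A B\<^esub>"
      by (rule T.minus_equality) simp_all
    ultimately show ?case unfolding Q_def by metis
  next
    case (diff x y)
    have "x - y \<in> carrier F" using diff keys_diff[of x y] by auto
    then have "?N #>\<^bsub>F\<^esub> x = (?N #>\<^bsub>F\<^esub> (x - y)) \<oplus>\<^bsub>tensor K A B\<^esub> (?N #>\<^bsub>F\<^esub> y)"
      using diff coset_add[of "x - y" y] by simp
    then have *: "?N #>\<^bsub>F\<^esub> (x - y) = (?N #>\<^bsub>F\<^esub> x) \<oplus>\<^bsub>tensor K A B\<^esub> (\<ominus>\<^bsub>tensor K A B\<^esub> (?N #>\<^bsub>F\<^esub> y))"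
      using diff coset_closed \<open>x - y \<in> carrier F\<close> by (simp add: T.a_assoc T.r_neg)
    then have **: "\<ominus>\<^bsub>tensor K A B\<^esub> (?N #>\<^bsub>F\<^esub> (x - y)) =
        (\<ominus>\<^bsub>tensor K A B\<^esub> (?N #>\<^bsub>F\<^esub> x)) \<oplus>\<^bsub>tensor K A B\<^esub> (?N #>\<^bsub>F\<^esub> y)"
      using diff coset_closed by (simp add: T.minus_add)
    have "P (?N #>\<^bsub>F\<^esub> (x - y))"
      unfolding * using diff coset_closed by (intro add) (auto simp: Q_def)
    moreover have "P (\<ominus>\<^bsub>tensor K A B\<^esub> (?N #>\<^bsub>F\<^esub> (x - y)))"
      unfolding ** using diff coset_closed by (intro add) (auto simp: Q_def)
    ultimately show ?case by (simp add: Q_def)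
  next
    case (of p)
    then show ?case
      using pure[of "fst p" "snd p"] pure[of "\<ominus>\<^bsub>A\<^esub> fst p" "snd p"] neg[of "fst p" "snd p"]
      by (auto simp: Q_def pure_def)
  qed
  then show ?thesis by (simp add: Q_def x)
qed

text \<open>Balancedness says exactly that the extension of \<open>f\<close> kills the relations. It is then constant on
every coset, which is what \<open>the_elem\<close> in the definition of \<open>tensor_ext\<close> needs.\<close>

lemma tensor_lift_coset:
  assumes "abelian_group D" "balanced K A B D f" "x \<in> carrier F"
  shows "tensor_lift K A B D f (tensor_null K A B #>\<^bsub>F\<^esub> x) =
    frag_prod (add_monoid D) (\<lambda>p. f (fst p) (snd p)) x"
proof -
  interpret D: abelian_group D by fact
  let ?h = "frag_prod (add_monoid D) (\<lambda>p. f (fst p) (snd p))"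
  have f: "(\<lambda>p. f (fst p) (snd p)) \<in> carrier A \<times> carrier B \<rightarrow> carrier D"
    using assms(2) by (auto simp: balanced_def)
  have hom: "?h \<in> hom F (add_monoid D)" by (rule D.add.frag_prod_hom[OF f])
  interpret h: group_hom F "add_monoid D" ?h
    by (simp add: group_hom_def group_hom_axioms_def hom D.a_group)
  have of: "?h (frag_of (a, b)) = f a b" if "a \<in> carrier A" "b \<in> carrier B" for a b
    using D.add.frag_prod_frag_of[of "\<lambda>p. f (fst p) (snd p)" "(a, b)"] that assms(2)
    by (simp add: balanced_def)
  have diff: "?h (u - v) = ?h u \<ominus>\<^bsub>D\<^esub> ?h v" if "u \<in> carrier F" "v \<in> carrier F" for u v
  proof -
    have "u - v \<in> carrier F" using that keys_diff[of u v] by auto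
    then have "?h u = ?h (u - v) \<oplus>\<^bsub>D\<^esub> ?h v" "?h (u - v) \<in> carrier D" "?h v \<in> carrier D"
      using h.hom_mult[of "u - v" v] h.hom_closed that by auto
    then show ?thesis by (simp add: D.a_assoc D.r_neg D.minus_eq)
  qed
  have rels: "?h r = \<zero>\<^bsub>D\<^esub>" if "r \<in> tensor_rels K A B" for r
  proof -
    have three: "?h (frag_of (a, b) - frag_of (a1, b1) - frag_of (a2, b2)) = \<zero>\<^bsub>D\<^esub>"
      if "f a b = f a1 b1 \<oplus>\<^bsub>D\<^esub> f a2 b2" and c: "a \<in> carrier A" "b \<in> carrier B" "a1 \<in> carrier A"
        "b1 \<in> carrier B" "a2 \<in> carrier A" "b2 \<in> carrier B" for a b a1 b1 a2 b2
    proof -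
      have "frag_of (a, b) - frag_of (a1, b1) \<in> carrier F"
        using c keys_diff[of "frag_of (a, b)" "frag_of (a1, b1)"] by (auto simp: keys_frag_of)
      moreover have "f a1 b1 \<in> carrier D" "f a2 b2 \<in> carrier D"
        using assms(2) c by (auto simp: balanced_def)
      ultimately show ?thesis
        using c that(1)
        by (simp add: diff of D.minus_eq D.a_assoc)
             (simp add: D.a_assoc[symmetric] D.minus_add[symmetric] D.r_neg)
    qed
    have two: "?h (frag_of (a, b) - frag_of (a1, b1)) = \<zero>\<^bsub>D\<^esub>"
      if "f a b = f a1 b1" and c: "a \<in> carrier A" "b \<in> carrier B" "a1 \<in> carrier A"
        "b1 \<in> carrier B" for a b a1 b1
    proof -
      have "f a1 b1 \<in> carrier D" using assms(2) c by (auto simp: balanced_def)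
      then show ?thesis using c that(1) by (simp add: diff of D.r_neg D.minus_eq)
    qed
    show ?thesis
      using that assms(2) unfolding tensor_rels_def balanced_def
      by (elim UnE CollectE exE conjE) (auto intro!: three two)
  qed
  have null: "?h n = \<zero>\<^bsub>D\<^esub> \<and> n \<in> carrier F" if "n \<in> tensor_null K A B" for n
    using that unfolding tensor_null_def
  proof (induction rule: generate.induct)
    case (inv g)
    then have "g \<in> carrier F" using tensor_rels_subset by blast
    then show ?case using rels[OF inv] h.hom_inv[of g] h.inv_closed[of g]
      by (simp add: a_inv_def[symmetric])
  next
    case one
    then show ?case using h.hom_one by simp
  next
    case (incl g)
    then show ?case using rels tensor_rels_subset by blast
  next
    case (eng g1 g2)
    then show ?case using h.hom_mult[of g1 g2] frag_add_closed[of g1 g2] by simp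
  qed
  have "?h y = ?h x" if "y \<in> tensor_null K A B #>\<^bsub>F\<^esub> x" for y
  proof -
    from that obtain n where n: "n \<in> tensor_null K A B" "y = n + x"
      unfolding r_coset_def mult_free_Abelian_group by blast
    then show ?thesis using null[of n] h.hom_mult[of n x] h.hom_closed[OF assms(3)] assms(3) by simp
  qed
  moreover have "x \<in> tensor_null K A B #>\<^bsub>F\<^esub> x"
    using group.rcos_self[OF group_free_Abelian_group assms(3)] null_normal by (simp add: normal_def)
  ultimately have "?h ` (tensor_null K A B #>\<^bsub>F\<^esub> x) = {?h x}" by blast
  then show ?thesis by (simp add: tensor_lift_def tensor_ext_def frag_prod_def)
qed

lemma tensor_lift_pure:
  assumes "abelian_group D" "balanced K A B D f" "a \<in> carrier A" "b \<in> carrier B"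
  shows "tensor_lift K A B D f (pure K A B a b) = f a b"
proof -
  interpret D: abelian_group D by fact
  show ?thesis
    using assms(2-) tensor_lift_coset[OF assms(1,2), of "frag_of (a, b)"]
      D.add.frag_prod_frag_of[of "\<lambda>p. f (fst p) (snd p)" "(a, b)"]
    by (simp add: pure_def balanced_def)
qed

lemma tensor_lift_hom:
  assumes "abelian_group D" "balanced K A B D f"
  shows "tensor_lift K A B D f \<in> hom (add_monoid (tensor K A B)) (add_monoid D)"
proof -
  interpret D: abelian_group D by fact
  have f: "(\<lambda>p. f (fst p) (snd p)) \<in> carrier A \<times> carrier B \<rightarrow> carrier D"
    using assms(2) by (auto simp: balanced_def)
  have h: "frag_prod (add_monoid D) (\<lambda>p. f (fst p) (snd p)) \<in> hom F (add_monoid D)"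
    by (rule D.add.frag_prod_hom[OF f])
  show ?thesis
  proof (rule homI)
    fix s assume "s \<in> carrier (add_monoid (tensor K A B))"
    then obtain x where "x \<in> carrier F" "s = tensor_null K A B #>\<^bsub>F\<^esub> x" by (auto elim: tensor_carrierE)
    then show "tensor_lift K A B D f s \<in> carrier (add_monoid D)"
      using hom_in_carrier[OF h] by (simp add: tensor_lift_coset[OF assms])
  next
    fix s t assume "s \<in> carrier (add_monoid (tensor K A B))" "t \<in> carrier (add_monoid (tensor K A B))"
    then obtain x y where xy: "x \<in> carrier F" "s = tensor_null K A B #>\<^bsub>F\<^esub> x"
      "y \<in> carrier F" "t = tensor_null K A B #>\<^bsub>F\<^esub> y" by (metis partial_object.select_convs(1) tensor_carrierE)
    have "x + y \<in> carrier F" using xy keys_add[of x y] by auto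
    then show "tensor_lift K A B D f (s \<otimes>\<^bsub>add_monoid (tensor K A B)\<^esub> t) =
       tensor_lift K A B D f s \<otimes>\<^bsub>add_monoid D\<^esub> tensor_lift K A B D f t"
      using hom_mult[OF h xy(1,3)] xy(1,3)
      by (simp add: xy coset_add[symmetric] tensor_lift_coset[OF assms])
  qed
qed

lemma tensor_lift_closed:
  "\<lbrakk>abelian_group D; balanced K A B D f; t \<in> carrier (tensor K A B)\<rbrakk> \<Longrightarrow>
    tensor_lift K A B D f t \<in> carrier D"
  using hom_in_carrier[OF tensor_lift_hom] by fastforce

lemma tensor_lift_add:
  "\<lbrakk>abelian_group D; balanced K A B D f; s \<in> carrier (tensor K A B); t \<in> carrier (tensor K A B)\<rbrakk> \<Longrightarrow>
    tensor_lift K A B D f (s \<oplus>\<^bsub>tensor K A B\<^esub> t) =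
      tensor_lift K A B D f s \<oplus>\<^bsub>D\<^esub> tensor_lift K A B D f t"
  using hom_mult[OF tensor_lift_hom] by fastforce

lemma balanced_cong:
  assumes "balanced K A B D f" "\<And>a b. \<lbrakk>a \<in> carrier A; b \<in> carrier B\<rbrakk> \<Longrightarrow> g a b = f a b"
  shows "balanced K A B D g"
  using assms unfolding balanced_def by simp

lemma tensor_lift_cong:
  assumes "abelian_group D" "balanced K A B D f" "t \<in> carrier (tensor K A B)"
    and "\<And>a b. \<lbrakk>a \<in> carrier A; b \<in> carrier B\<rbrakk> \<Longrightarrow> g a b = f a b"
  shows "tensor_lift K A B D g t = tensor_lift K A B D f t"
  using assms(3)
  by (induction t rule: tensor_induct)
     (simp_all add: tensor_lift_pure tensor_lift_add balanced_cong[of D f g] assms)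

end

context tensor_pair
begin

interpretation A: module K A by (rule left_module)
interpretation B: module K B by (rule right_module)
interpretation T: abelian_group "tensor K A B" by (rule tensor_abelian_group)

lemma smult_balanced:
  "r \<in> carrier K \<Longrightarrow> balanced K A B (tensor K A B) (\<lambda>a b. pure K A B (r \<odot>\<^bsub>A\<^esub> a) b)"
  unfolding balanced_def
  by (auto simp: pure_add_l pure_add_r A.smult_r_distr pure_smult[symmetric] A.smult_assoc1[symmetric]
      A.R.m_comm)

lemma tensor_smult_pure:
  "\<lbrakk>r \<in> carrier K; a \<in> carrier A; b \<in> carrier B\<rbrakk> \<Longrightarrow>
    r \<odot>\<^bsub>tensor K A B\<^esub> pure K A B a b = pure K A B (r \<odot>\<^bsub>A\<^esub> a) b"
  by (simp add: tensor_smult_lift tensor_lift_pure[OF tensor_abelian_group smult_balanced])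

lemma tensor_smult_add:
  "\<lbrakk>r \<in> carrier K; s \<in> carrier (tensor K A B); t \<in> carrier (tensor K A B)\<rbrakk> \<Longrightarrow>
    r \<odot>\<^bsub>tensor K A B\<^esub> (s \<oplus>\<^bsub>tensor K A B\<^esub> t) =
      (r \<odot>\<^bsub>tensor K A B\<^esub> s) \<oplus>\<^bsub>tensor K A B\<^esub> (r \<odot>\<^bsub>tensor K A B\<^esub> t)"
  by (simp add: tensor_smult_lift tensor_lift_add[OF tensor_abelian_group smult_balanced])

lemma tensor_smult_closed:
  "\<lbrakk>r \<in> carrier K; t \<in> carrier (tensor K A B)\<rbrakk> \<Longrightarrow>
    r \<odot>\<^bsub>tensor K A B\<^esub> t \<in> carrier (tensor K A B)"
  by (simp add: tensor_smult_lift tensor_lift_closed[OF tensor_abelian_group smult_balanced])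

lemma tensor_module: "module K (tensor K A B)"
proof (rule moduleI)
  let ?T = "tensor K A B"
  note [simp] = tensor_smult_pure tensor_smult_add tensor_smult_closed
  show "(r \<oplus>\<^bsub>K\<^esub> s) \<odot>\<^bsub>?T\<^esub> t = r \<odot>\<^bsub>?T\<^esub> t \<oplus>\<^bsub>?T\<^esub> s \<odot>\<^bsub>?T\<^esub> t"
    if "r \<in> carrier K" "s \<in> carrier K" "t \<in> carrier ?T" for r s t
    using that(3)
  proof (induction t rule: tensor_induct)
    case (add t u)
    then show ?case using that(1,2) by (simp add: T.a_ac)
  qed (use that(1,2) in \<open>simp add: A.smult_l_distr pure_add_l\<close>)
  show "(r \<otimes>\<^bsub>K\<^esub> s) \<odot>\<^bsub>?T\<^esub> t = r \<odot>\<^bsub>?T\<^esub> (s \<odot>\<^bsub>?T\<^esub> t)"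
    if "r \<in> carrier K" "s \<in> carrier K" "t \<in> carrier ?T" for r s t
    using that(3)
    by (induction t rule: tensor_induct) (use that(1,2) in \<open>simp_all add: A.smult_assoc1\<close>)
  show "\<one>\<^bsub>K\<^esub> \<odot>\<^bsub>?T\<^esub> t = t" if "t \<in> carrier ?T" for t
    using that by (induction t rule: tensor_induct) simp_all
qed (use tensor_smult_add tensor_smult_closed tensor_abelian_group A.R.is_cring in auto)

end

section \<open>Tensor products of algebras\<close>

locale tensor_algebra =
  fixes K :: "('k, 'r) ring_scheme" and A :: "('k, 'a, 'm) module_scheme"
    and B :: "('k, 'b, 'n) module_scheme"
  assumes left_algebra: "nc_algebra K A" and right_algebra: "nc_algebra K B"

sublocale tensor_algebra \<subseteq> tensor_pair K A B
  using left_algebra right_algebra by (simp add: tensor_pair_def nc_algebra_def)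

context tensor_algebra
begin

interpretation A: nc_algebra K A by (rule left_algebra)
interpretation B: nc_algebra K B by (rule right_algebra)
interpretation T: abelian_group "tensor K A B" by (rule tensor_abelian_group)

lemma mult_balanced_right:
  "\<lbrakk>a \<in> carrier A; b \<in> carrier B\<rbrakk> \<Longrightarrow>
    balanced K A B (tensor K A B) (\<lambda>a' b'. pure K A B (a \<otimes>\<^bsub>A\<^esub> a') (b \<otimes>\<^bsub>B\<^esub> b'))"
  unfolding balanced_def
  by (auto simp: pure_add_l pure_add_r A.r_distr B.r_distr A.smult_mult_r B.smult_mult_r pure_smult)

abbreviation pure_mult :: "'a \<Rightarrow> 'b \<Rightarrow> ('a \<times> 'b \<Rightarrow>\<^sub>0 int) set \<Rightarrow> ('a \<times> 'b \<Rightarrow>\<^sub>0 int) set"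
  where "pure_mult a b \<equiv> tensor_lift K A B (tensor K A B)
    (\<lambda>a' b'. pure K A B (a \<otimes>\<^bsub>A\<^esub> a') (b \<otimes>\<^bsub>B\<^esub> b'))"

lemmas pure_mult_pure = tensor_lift_pure[OF tensor_abelian_group mult_balanced_right]
lemmas pure_mult_add = tensor_lift_add[OF tensor_abelian_group mult_balanced_right]
lemmas pure_mult_closed = tensor_lift_closed[OF tensor_abelian_group mult_balanced_right]

text \<open>The product is a lift in the left argument of lifts in the right one. The inner lift depends on the
pure tensor at the left in a balanced way because it does so at each pure tensor at the right.\<close>

lemma mult_balanced_left:
  assumes "t \<in> carrier (tensor K A B)"
  shows "balanced K A B (tensor K A B) (\<lambda>a b. pure_mult a b t)"
  unfolding balanced_def
proof (intro conjI ballI)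
  fix a b assume ab: "a \<in> carrier A" "b \<in> carrier B"
  show "pure_mult a b t \<in> carrier (tensor K A B)" using assms ab by (rule pure_mult_closed[rotated 2])
  show "pure_mult (a \<oplus>\<^bsub>A\<^esub> a') b t = pure_mult a b t \<oplus>\<^bsub>tensor K A B\<^esub> pure_mult a' b t"
    if "a' \<in> carrier A" for a'
    using assms
  proof (induction t rule: tensor_induct)
    case (add t u)
    then show ?case using ab that by (simp add: pure_mult_add pure_mult_closed T.a_ac)
  qed (use ab that in \<open>simp add: pure_mult_pure A.l_distr pure_add_l\<close>)
  show "pure_mult a (b \<oplus>\<^bsub>B\<^esub> b') t = pure_mult a b t \<oplus>\<^bsub>tensor K A B\<^esub> pure_mult a b' t"
    if "b' \<in> carrier B" for b'
    using assms
  proof (induction t rule: tensor_induct)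
    case (add t u)
    then show ?case using ab that by (simp add: pure_mult_add pure_mult_closed T.a_ac)
  qed (use ab that in \<open>simp add: pure_mult_pure B.l_distr pure_add_r\<close>)
  show "pure_mult (r \<odot>\<^bsub>A\<^esub> a) b t = pure_mult a (r \<odot>\<^bsub>B\<^esub> b) t" if "r \<in> carrier K" for r
    using assms
  proof (induction t rule: tensor_induct)
    case (add t u)
    then show ?case using ab that by (simp add: pure_mult_add)
  qed (use ab that in \<open>simp add: pure_mult_pure A.smult_mult_l B.smult_mult_l pure_smult\<close>)
qed

lemma tensor_mult_pure_left:
  "\<lbrakk>a \<in> carrier A; b \<in> carrier B; t \<in> carrier (tensor K A B)\<rbrakk> \<Longrightarrow>
    pure K A B a b \<otimes>\<^bsub>tensor K A B\<^esub> t = pure_mult a b t"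
  by (simp add: tensor_mult_lift tensor_lift_pure[OF tensor_abelian_group mult_balanced_left])

lemma tensor_mult_pure:
  "\<lbrakk>a \<in> carrier A; b \<in> carrier B; a' \<in> carrier A; b' \<in> carrier B\<rbrakk> \<Longrightarrow>
    pure K A B a b \<otimes>\<^bsub>tensor K A B\<^esub> pure K A B a' b' = pure K A B (a \<otimes>\<^bsub>A\<^esub> a') (b \<otimes>\<^bsub>B\<^esub> b')"
  by (simp add: tensor_mult_pure_left pure_mult_pure)

lemma tensor_mult_closed:
  "\<lbrakk>s \<in> carrier (tensor K A B); t \<in> carrier (tensor K A B)\<rbrakk> \<Longrightarrow>
    s \<otimes>\<^bsub>tensor K A B\<^esub> t \<in> carrier (tensor K A B)"
  by (simp add: tensor_mult_lift tensor_lift_closed[OF tensor_abelian_group mult_balanced_left])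

lemma tensor_l_distr:
  "\<lbrakk>s \<in> carrier (tensor K A B); t \<in> carrier (tensor K A B); u \<in> carrier (tensor K A B)\<rbrakk> \<Longrightarrow>
    (s \<oplus>\<^bsub>tensor K A B\<^esub> t) \<otimes>\<^bsub>tensor K A B\<^esub> u =
      (s \<otimes>\<^bsub>tensor K A B\<^esub> u) \<oplus>\<^bsub>tensor K A B\<^esub> (t \<otimes>\<^bsub>tensor K A B\<^esub> u)"
  by (simp add: tensor_mult_lift tensor_lift_add[OF tensor_abelian_group mult_balanced_left])

lemma tensor_r_distr:
  assumes "s \<in> carrier (tensor K A B)" "t \<in> carrier (tensor K A B)" "u \<in> carrier (tensor K A B)"
  shows "u \<otimes>\<^bsub>tensor K A B\<^esub> (s \<oplus>\<^bsub>tensor K A B\<^esub> t) =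
      (u \<otimes>\<^bsub>tensor K A B\<^esub> s) \<oplus>\<^bsub>tensor K A B\<^esub> (u \<otimes>\<^bsub>tensor K A B\<^esub> t)"
  using assms(3)
proof (induction u rule: tensor_induct)
  case (pure a b)
  then show ?case using assms(1,2) by (simp add: tensor_mult_pure_left pure_mult_add)
next
  case (add u v)
  then show ?case using assms(1,2) by (simp add: tensor_l_distr tensor_mult_closed T.a_ac)
qed

text \<open>All laws are additive in each argument, which leaves the case of pure tensors.\<close>

lemma tensor_nc_algebra: "nc_algebra K (tensor K A B)"
proof -
  let ?T = "tensor K A B"
  note [simp] = tensor_mult_pure tensor_mult_closed tensor_l_distr tensor_r_distr tensor_smult_pure
    tensor_smult_add tensor_smult_closed
  have one: "\<one>\<^bsub>?T\<^esub> \<in> carrier ?T" by (simp add: tensor_one)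
  have assoc: "(s \<otimes>\<^bsub>?T\<^esub> t) \<otimes>\<^bsub>?T\<^esub> u = s \<otimes>\<^bsub>?T\<^esub> (t \<otimes>\<^bsub>?T\<^esub> u)"
    if "s \<in> carrier ?T" "t \<in> carrier ?T" "u \<in> carrier ?T" for s t u
    using that(1)
  proof (induction s rule: tensor_induct)
    case (pure a b)
    note ab = this
    show ?case using that(2)
    proof (induction t rule: tensor_induct)
      case (pure a' b')
      show ?case using that(3)
        by (induction u rule: tensor_induct) (use ab pure in \<open>simp_all add: A.m_assoc B.m_assoc\<close>)
    qed (use ab that(3) in simp)
  qed (use that(2,3) in simp)
  have l_one: "\<one>\<^bsub>?T\<^esub> \<otimes>\<^bsub>?T\<^esub> t = t" if "t \<in> carrier ?T" for t
    using that unfolding tensor_one by (induction t rule: tensor_induct) simp_all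
  have r_one: "t \<otimes>\<^bsub>?T\<^esub> \<one>\<^bsub>?T\<^esub> = t" if "t \<in> carrier ?T" for t
    using that unfolding tensor_one by (induction t rule: tensor_induct) simp_all
  have smult_l: "(r \<odot>\<^bsub>?T\<^esub> s) \<otimes>\<^bsub>?T\<^esub> t = r \<odot>\<^bsub>?T\<^esub> (s \<otimes>\<^bsub>?T\<^esub> t)"
    if "r \<in> carrier K" "s \<in> carrier ?T" "t \<in> carrier ?T" for r s t
    using that(2)
  proof (induction s rule: tensor_induct)
    case (pure a b)
    show ?case using that(3)
      by (induction t rule: tensor_induct) (use pure that(1) in \<open>simp_all add: A.smult_mult_l\<close>)
  qed (use that(1,3) in simp)
  have smult_r: "s \<otimes>\<^bsub>?T\<^esub> (r \<odot>\<^bsub>?T\<^esub> t) = r \<odot>\<^bsub>?T\<^esub> (s \<otimes>\<^bsub>?T\<^esub> t)"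
    if "r \<in> carrier K" "s \<in> carrier ?T" "t \<in> carrier ?T" for r s t
    using that(2)
  proof (induction s rule: tensor_induct)
    case (pure a b)
    show ?case using that(3)
      by (induction t rule: tensor_induct) (use pure that(1) in \<open>simp_all add: A.smult_mult_r\<close>)
  qed (use that(1,3) in simp)
  have "monoid ?T" by (rule monoidI) (simp_all add: one assoc l_one r_one)
  then have "ring ?T"
    by (intro ringI tensor_abelian_group) simp_all
  then show ?thesis
    unfolding nc_algebra_def nc_algebra_axioms_def using tensor_module smult_l smult_r by blast
qed

end

section \<open>Algebra homomorphisms with commuting images\<close>

text \<open>Domain and codomain are part of the predicate, so that a homomorphism carries the facts that both
sides are algebras.\<close>

locale alg_hom =
  fixes K :: "('k, 'r) ring_scheme" and A :: "('k, 'a, 'm) module_scheme"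
    and D :: "('k, 'd, 'l) module_scheme" and \<alpha> :: "'a \<Rightarrow> 'd"
  assumes dom: "nc_algebra K A" and cod: "nc_algebra K D"
    and ring_hom: "\<alpha> \<in> ring_hom A D" and linear: "\<alpha> \<in> linear_maps K A D"
begin

interpretation A: nc_algebra K A by (rule dom)
interpretation D: nc_algebra K D by (rule cod)

lemma
  assumes "x \<in> carrier A"
  shows closed [simp]: "\<alpha> x \<in> carrier D"
    and add: "y \<in> carrier A \<Longrightarrow> \<alpha> (x \<oplus>\<^bsub>A\<^esub> y) = \<alpha> x \<oplus>\<^bsub>D\<^esub> \<alpha> y"
    and mult: "y \<in> carrier A \<Longrightarrow> \<alpha> (x \<otimes>\<^bsub>A\<^esub> y) = \<alpha> x \<otimes>\<^bsub>D\<^esub> \<alpha> y"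
    and smult: "r \<in> carrier K \<Longrightarrow> \<alpha> (r \<odot>\<^bsub>A\<^esub> x) = r \<odot>\<^bsub>D\<^esub> \<alpha> x"
  using assms ring_hom linear
  by (auto simp: ring_hom_closed ring_hom_add ring_hom_mult linear_maps_def)

lemma one: "\<alpha> \<one>\<^bsub>A\<^esub> = \<one>\<^bsub>D\<^esub>"
  using ring_hom by (rule ring_hom_one)

lemma Units: "x \<in> Units A \<Longrightarrow> \<alpha> x \<in> Units D"
  and inverse: "x \<in> Units A \<Longrightarrow> \<alpha> (inv\<^bsub>A\<^esub> x) = inv\<^bsub>D\<^esub> (\<alpha> x)"
proof -
  assume x: "x \<in> Units A"
  then have *: "\<alpha> x \<otimes>\<^bsub>D\<^esub> \<alpha> (inv\<^bsub>A\<^esub> x) = \<one>\<^bsub>D\<^esub>" "\<alpha> (inv\<^bsub>A\<^esub> x) \<otimes>\<^bsub>D\<^esub> \<alpha> x = \<one>\<^bsub>D\<^esub>"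
    by (simp_all add: A.Units_closed flip: mult one)
  then show "\<alpha> x \<in> Units D"
    using A.Units_closed[OF x] A.Units_inv_closed[OF x] unfolding Units_def by auto
  show "\<alpha> (inv\<^bsub>A\<^esub> x) = inv\<^bsub>D\<^esub> (\<alpha> x)"
    using * x by (intro D.inv_unique') (auto simp: A.Units_closed)
qed

end

lemma alg_homI:
  assumes "nc_algebra K A" "nc_algebra K D"
    and "\<And>x. x \<in> carrier A \<Longrightarrow> \<alpha> x \<in> carrier D"
    and "\<And>x y. \<lbrakk>x \<in> carrier A; y \<in> carrier A\<rbrakk> \<Longrightarrow> \<alpha> (x \<oplus>\<^bsub>A\<^esub> y) = \<alpha> x \<oplus>\<^bsub>D\<^esub> \<alpha> y"
    and "\<And>x y. \<lbrakk>x \<in> carrier A; y \<in> carrier A\<rbrakk> \<Longrightarrow> \<alpha> (x \<otimes>\<^bsub>A\<^esub> y) = \<alpha> x \<otimes>\<^bsub>D\<^esub> \<alpha> y"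
    and "\<And>r x. \<lbrakk>r \<in> carrier K; x \<in> carrier A\<rbrakk> \<Longrightarrow> \<alpha> (r \<odot>\<^bsub>A\<^esub> x) = r \<odot>\<^bsub>D\<^esub> \<alpha> x"
    and "\<alpha> \<one>\<^bsub>A\<^esub> = \<one>\<^bsub>D\<^esub>"
  shows "alg_hom K A D \<alpha>"
  using assms by (auto simp: alg_hom_def linear_maps_def intro!: ring_hom_memI)

lemma alg_hom_comp:
  assumes "alg_hom K A D \<alpha>" "alg_hom K D E \<beta>"
  shows "alg_hom K A E (\<lambda>x. \<beta> (\<alpha> x))"
proof -
  interpret f: alg_hom K A D \<alpha> by fact
  interpret g: alg_hom K D E \<beta> by fact
  show ?thesis
    by (rule alg_homI) (simp_all add: f.dom g.cod f.add g.add f.mult g.mult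
        f.smult g.smult f.one g.one)
qed

lemma alg_hom_id:
  assumes "nc_algebra K A"
  shows "alg_hom K A A (\<lambda>x. x)"
  by (rule alg_homI) (simp_all add: assms)

lemma alg_hom_cong:
  assumes "alg_hom K A D \<alpha>" "\<And>x. x \<in> carrier A \<Longrightarrow> \<beta> x = \<alpha> x"
  shows "alg_hom K A D \<beta>"
proof -
  interpret alg_hom K A D \<alpha> by fact
  interpret A: nc_algebra K A by (rule dom)
  show ?thesis
    by (rule alg_homI)
       (simp_all add: assms(2) dom cod add mult smult one)
qed

context tensor_algebra
begin

interpretation A: nc_algebra K A by (rule left_algebra)
interpretation B: nc_algebra K B by (rule right_algebra)
interpretation T: nc_algebra K "tensor K A B" by (rule tensor_nc_algebra)

lemma inl_hom: "alg_hom K A (tensor K A B) (\<lambda>a. pure K A B a \<one>\<^bsub>B\<^esub>)"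
  by (rule alg_homI)
     (simp_all add: left_algebra tensor_nc_algebra pure_add_l tensor_mult_pure
       tensor_smult_pure tensor_one)

lemma inr_hom: "alg_hom K B (tensor K A B) (\<lambda>b. pure K A B \<one>\<^bsub>A\<^esub> b)"
  by (rule alg_homI)
     (simp_all add: right_algebra tensor_nc_algebra pure_add_r tensor_mult_pure
       tensor_smult_pure pure_smult tensor_one)

lemma hom_pure:
  assumes "alg_hom K (tensor K A B) D h" "a \<in> carrier A" "b \<in> carrier B"
  shows "h (pure K A B a b) = h (pure K A B a \<one>\<^bsub>B\<^esub>) \<otimes>\<^bsub>D\<^esub> h (pure K A B \<one>\<^bsub>A\<^esub> b)"
proof -
  interpret h: alg_hom K "tensor K A B" D h by fact
  show ?thesis using assms by (simp add: tensor_mult_pure flip: h.mult)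
qed

text \<open>As a ring, \<open>A \<otimes> B\<close> is generated by the elements \<open>a \<otimes> 1\<close> and \<open>1 \<otimes> b\<close>.\<close>

lemma hom_eqI:
  assumes "alg_hom K (tensor K A B) D f" "alg_hom K (tensor K A B) D g"
    and "\<And>a. a \<in> carrier A \<Longrightarrow> f (pure K A B a \<one>\<^bsub>B\<^esub>) = g (pure K A B a \<one>\<^bsub>B\<^esub>)"
    and "\<And>b. b \<in> carrier B \<Longrightarrow> f (pure K A B \<one>\<^bsub>A\<^esub> b) = g (pure K A B \<one>\<^bsub>A\<^esub> b)"
    and "t \<in> carrier (tensor K A B)"
  shows "f t = g t"
proof -
  interpret f: alg_hom K "tensor K A B" D f by fact
  interpret g: alg_hom K "tensor K A B" D g by fact
  show ?thesis using assms(5)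
  proof (induction t rule: tensor_induct)
    case (pure a b)
    then show ?case
      using hom_pure[OF assms(1), of a b] hom_pure[OF assms(2), of a b] assms(3,4) by simp
  qed (simp add: f.add g.add)
qed

end

locale commuting_homs = f: alg_hom K A D \<alpha> + g: alg_hom K B D \<beta> for K A B D \<alpha> \<beta> +
  assumes comm: "\<lbrakk>a \<in> carrier A; b \<in> carrier B\<rbrakk> \<Longrightarrow> \<alpha> a \<otimes>\<^bsub>D\<^esub> \<beta> b = \<beta> b \<otimes>\<^bsub>D\<^esub> \<alpha> a"

sublocale commuting_homs \<subseteq> tensor_algebra K A B
  by (rule tensor_algebra.intro[OF f.dom g.dom])

text \<open>The tensor product is the coproduct of \<open>A\<close> and \<open>B\<close> with respect to pairs of homomorphisms whose
images commute; this is the map induced by such a pair.\<close>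

definition copair ::
  "('k, 'r) ring_scheme \<Rightarrow> ('k, 'a, 'm) module_scheme \<Rightarrow> ('k, 'b, 'n) module_scheme \<Rightarrow>
     ('k, 'd, 'l) module_scheme \<Rightarrow> ('a \<Rightarrow> 'd) \<Rightarrow> ('b \<Rightarrow> 'd) \<Rightarrow> ('a \<times> 'b \<Rightarrow>\<^sub>0 int) set \<Rightarrow> 'd"
  where "copair K A B D \<alpha> \<beta> = tensor_lift K A B D (\<lambda>a b. \<alpha> a \<otimes>\<^bsub>D\<^esub> \<beta> b)"

lemma commuting_homs_sym: "commuting_homs K A B D \<alpha> \<beta> \<Longrightarrow> commuting_homs K B A D \<beta> \<alpha>"
  by (simp add: commuting_homs_def commuting_homs_axioms_def)

context commuting_homs
begin

interpretation A: nc_algebra K A by (rule left_algebra)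
interpretation B: nc_algebra K B by (rule right_algebra)
interpretation T: nc_algebra K "tensor K A B" by (rule tensor_nc_algebra)
interpretation D: nc_algebra K D by (rule f.cod)

lemma copair_balanced: "balanced K A B D (\<lambda>a b. \<alpha> a \<otimes>\<^bsub>D\<^esub> \<beta> b)"
  unfolding balanced_def
  by (auto simp: f.add g.add f.smult g.smult D.l_distr D.r_distr D.smult_mult_l D.smult_mult_r)

lemmas copair_closed [simp] =
  tensor_lift_closed[OF D.abelian_group_axioms copair_balanced, folded copair_def]
lemmas copair_add =
  tensor_lift_add[OF D.abelian_group_axioms copair_balanced, folded copair_def]
lemmas copair_pure =
  tensor_lift_pure[OF D.abelian_group_axioms copair_balanced, folded copair_def]
lemmas lift_eq_copair =
  tensor_lift_cong[OF D.abelian_group_axioms copair_balanced, folded copair_def]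

text \<open>Multiplicativity needs the commuting images:
\<open>\<alpha> a \<cdot> \<beta> b \<cdot> \<alpha> a' \<cdot> \<beta> b' = \<alpha> (a a') \<cdot> \<beta> (b b')\<close>.\<close>

lemma copair_hom: "alg_hom K (tensor K A B) D (copair K A B D \<alpha> \<beta>)"
proof (rule alg_homI)
  let ?T = "tensor K A B" and ?j = "copair K A B D \<alpha> \<beta>"
  have pure_pure: "?j (pure K A B a b \<otimes>\<^bsub>?T\<^esub> pure K A B a' b') = ?j (pure K A B a b) \<otimes>\<^bsub>D\<^esub> ?j (pure K A B a' b')"
    if "a \<in> carrier A" "b \<in> carrier B" "a' \<in> carrier A" "b' \<in> carrier B" for a b a' b'
  proof -
    have "\<alpha> a' \<otimes>\<^bsub>D\<^esub> (\<beta> b \<otimes>\<^bsub>D\<^esub> \<beta> b') = \<beta> b \<otimes>\<^bsub>D\<^esub> (\<alpha> a' \<otimes>\<^bsub>D\<^esub> \<beta> b')"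
      using that comm[of a' b] by (simp flip: D.m_assoc)
    then show ?thesis
      using that by (simp add: tensor_mult_pure copair_pure f.mult g.mult D.m_assoc)
  qed
  show "?j (s \<otimes>\<^bsub>?T\<^esub> t) = ?j s \<otimes>\<^bsub>D\<^esub> ?j t" if "s \<in> carrier ?T" "t \<in> carrier ?T" for s t
    using that(1)
  proof (induction s rule: tensor_induct)
    case (pure a b)
    show ?case using that(2)
      by (induction t rule: tensor_induct)
         (use pure in \<open>simp_all add: pure_pure copair_add T.r_distr D.r_distr\<close>)
  qed (use that(2) in \<open>simp add: copair_add T.l_distr D.l_distr\<close>)
  show "?j (r \<odot>\<^bsub>?T\<^esub> t) = r \<odot>\<^bsub>D\<^esub> ?j t" if "r \<in> carrier K" "t \<in> carrier ?T" for r t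
    using that(2)
    by (induction t rule: tensor_induct)
       (use that(1) in \<open>simp_all add: tensor_smult_pure tensor_smult_add copair_pure copair_add f.smult D.smult_mult_l
         D.smult_r_distr\<close>)
  show "?j \<one>\<^bsub>?T\<^esub> = \<one>\<^bsub>D\<^esub>" by (simp add: tensor_one copair_pure f.one g.one)
qed (simp_all add: tensor_nc_algebra f.cod copair_add)

sublocale j: alg_hom K "tensor K A B" D "copair K A B D \<alpha> \<beta>" by (rule copair_hom)

lemma copair_inl: "a \<in> carrier A \<Longrightarrow> copair K A B D \<alpha> \<beta> (pure K A B a \<one>\<^bsub>B\<^esub>) = \<alpha> a"
  by (simp add: copair_pure g.one)

lemma copair_inr: "b \<in> carrier B \<Longrightarrow> copair K A B D \<alpha> \<beta> (pure K A B \<one>\<^bsub>A\<^esub> b) = \<beta> b"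
  by (simp add: copair_pure f.one)

lemma commuting_homs_comp:
  assumes "alg_hom K D E \<theta>"
  shows "commuting_homs K A B E (\<lambda>a. \<theta> (\<alpha> a)) (\<lambda>b. \<theta> (\<beta> b))"
proof -
  interpret t: alg_hom K D E \<theta> by fact
  show ?thesis
    by (intro commuting_homs.intro commuting_homs_axioms.intro alg_hom_comp[OF f.alg_hom_axioms]
        alg_hom_comp[OF g.alg_hom_axioms] assms) (simp add: comm flip: t.mult)
qed

lemma copair_comp:
  assumes "alg_hom K D E \<theta>" "t \<in> carrier (tensor K A B)"
  shows "\<theta> (copair K A B D \<alpha> \<beta> t) = copair K A B E (\<lambda>a. \<theta> (\<alpha> a)) (\<lambda>b. \<theta> (\<beta> b)) t"
proof -
  note * = commuting_homs_comp[OF assms(1)]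
  show ?thesis
    by (rule hom_eqI[OF alg_hom_comp[OF copair_hom assms(1)] commuting_homs.copair_hom[OF *] _ _ assms(2)])
       (simp_all add: copair_inl copair_inr commuting_homs.copair_inl[OF *] commuting_homs.copair_inr[OF *])
qed

lemma copair_cong:
  assumes "\<And>a. a \<in> carrier A \<Longrightarrow> \<alpha>' a = \<alpha> a" "\<And>b. b \<in> carrier B \<Longrightarrow> \<beta>' b = \<beta> b"
    and "t \<in> carrier (tensor K A B)"
  shows "copair K A B D \<alpha>' \<beta>' t = copair K A B D \<alpha> \<beta> t"
  unfolding copair_def[of K A B D \<alpha>'] using assms by (intro lift_eq_copair) auto

text \<open>The centralizer of \<open>z\<close> is a subring. This makes copairs of commuting homomorphisms commute with
further homomorphisms, so that copairs can be nested.\<close>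

lemma commute_copair:
  assumes "z \<in> carrier D" "t \<in> carrier (tensor K A B)"
    and "\<And>a. a \<in> carrier A \<Longrightarrow> z \<otimes>\<^bsub>D\<^esub> \<alpha> a = \<alpha> a \<otimes>\<^bsub>D\<^esub> z"
    and "\<And>b. b \<in> carrier B \<Longrightarrow> z \<otimes>\<^bsub>D\<^esub> \<beta> b = \<beta> b \<otimes>\<^bsub>D\<^esub> z"
  shows "z \<otimes>\<^bsub>D\<^esub> copair K A B D \<alpha> \<beta> t = copair K A B D \<alpha> \<beta> t \<otimes>\<^bsub>D\<^esub> z"
  using assms(2)
proof (induction t rule: tensor_induct)
  case (pure a b)
  have "z \<otimes>\<^bsub>D\<^esub> (\<alpha> a \<otimes>\<^bsub>D\<^esub> \<beta> b) = \<alpha> a \<otimes>\<^bsub>D\<^esub> (z \<otimes>\<^bsub>D\<^esub> \<beta> b)"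
    using assms(1) assms(3)[of a] pure by (simp flip: D.m_assoc)
  then show ?case
    using assms(1) assms(4)[of b] pure by (simp add: copair_pure D.m_assoc)
qed (use assms(1) in \<open>simp add: copair_add D.l_distr D.r_distr\<close>)

lemma copair_flip:
  assumes "t \<in> carrier (tensor K A B)"
  shows "copair K B A D \<beta> \<alpha> (tensor_flip K A B t) = copair K A B D \<alpha> \<beta> t"
proof -
  interpret ba: commuting_homs K B A D \<beta> \<alpha>
    by (rule commuting_homs_sym) (rule commuting_homs_axioms)
  have bal: "balanced K A B (tensor K B A) (\<lambda>a b. pure K B A b a)"
    unfolding balanced_def by (auto simp: ba.pure_add_l ba.pure_add_r ba.pure_smult)
  note fl = tensor_lift_pure[OF ba.tensor_abelian_group bal]
    tensor_lift_add[OF ba.tensor_abelian_group bal] tensor_lift_closed[OF ba.tensor_abelian_group bal]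
  show ?thesis unfolding tensor_flip_def using assms
    by (induction t rule: tensor_induct)
       (simp_all add: fl ba.copair_pure ba.copair_add copair_pure copair_add comm)
qed

end

lemma commuting_homs_copair_left:
  assumes "commuting_homs K A B D \<alpha> \<beta>" "commuting_homs K A A0 D \<alpha> \<gamma>" "commuting_homs K B A0 D \<beta> \<gamma>"
  shows "commuting_homs K (tensor K A B) A0 D (copair K A B D \<alpha> \<beta>) \<gamma>"
proof -
  interpret ab: commuting_homs K A B D \<alpha> \<beta> by fact
  interpret ax: commuting_homs K A A0 D \<alpha> \<gamma> by fact
  interpret bx: commuting_homs K B A0 D \<beta> \<gamma> by fact
  show ?thesis
    by (intro commuting_homs.intro commuting_homs_axioms.intro ab.copair_hom ax.g.alg_hom_axioms)
       (simp add: ab.commute_copair ax.comm bx.comm)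
qed

lemma commuting_homs_copair_right:
  assumes "commuting_homs K A B D \<alpha> \<beta>" "commuting_homs K A0 A D \<gamma> \<alpha>" "commuting_homs K A0 B D \<gamma> \<beta>"
  shows "commuting_homs K A0 (tensor K A B) D \<gamma> (copair K A B D \<alpha> \<beta>)"
  by (intro commuting_homs_sym[OF commuting_homs_copair_left] assms commuting_homs_sym[OF assms(2)]
      commuting_homs_sym[OF assms(3)])

lemma commuting_homs_comp_left:
  assumes "alg_hom K A0 A \<theta>" "commuting_homs K A B D \<alpha> \<beta>"
  shows "commuting_homs K A0 B D (\<lambda>x. \<alpha> (\<theta> x)) \<beta>"
proof -
  interpret t: alg_hom K A0 A \<theta> by fact
  interpret ab: commuting_homs K A B D \<alpha> \<beta> by fact
  show ?thesis
    by (intro commuting_homs.intro commuting_homs_axioms.intro alg_hom_comp[OF assms(1)]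
        ab.f.alg_hom_axioms ab.g.alg_hom_axioms) (simp add: ab.comm)
qed

lemma commuting_homs_comp_right:
  assumes "alg_hom K A0 B \<theta>" "commuting_homs K A B D \<alpha> \<beta>"
  shows "commuting_homs K A A0 D \<alpha> (\<lambda>x. \<beta> (\<theta> x))"
  by (rule commuting_homs_sym) (rule commuting_homs_comp_left[OF assms(1) commuting_homs_sym[OF assms(2)]])

lemma (in tensor_algebra) inl_inr_commuting:
  "commuting_homs K A B (tensor K A B) (\<lambda>a. pure K A B a \<one>\<^bsub>B\<^esub>) (\<lambda>b. pure K A B \<one>\<^bsub>A\<^esub> b)"
proof -
  interpret A: nc_algebra K A by (rule left_algebra)
  interpret B: nc_algebra K B by (rule right_algebra)
  show ?thesis
    by (intro commuting_homs.intro commuting_homs_axioms.intro inl_hom inr_hom)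
       (simp add: tensor_mult_pure)
qed

lemma (in tensor_algebra) copair_inl_inr:
  "t \<in> carrier (tensor K A B) \<Longrightarrow>
    copair K A B (tensor K A B) (\<lambda>a. pure K A B a \<one>\<^bsub>B\<^esub>) (\<lambda>b. pure K A B \<one>\<^bsub>A\<^esub> b) t = t"
proof -
  interpret j: commuting_homs K A B "tensor K A B" "\<lambda>a. pure K A B a \<one>\<^bsub>B\<^esub>" "\<lambda>b. pure K A B \<one>\<^bsub>A\<^esub> b"
    by (rule inl_inr_commuting)
  show "t \<in> carrier (tensor K A B) \<Longrightarrow> ?thesis"
    by (rule hom_eqI[OF j.copair_hom alg_hom_id[OF tensor_nc_algebra]])
       (simp_all add: j.copair_inl j.copair_inr)
qed

lemma tensor_map_eq_copair:
  assumes "alg_hom K A0 A \<alpha>" "alg_hom K Y B \<beta>" "t \<in> carrier (tensor K A0 Y)"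
  shows "tensor_map K A0 Y A B \<alpha> \<beta> t =
      copair K A0 Y (tensor K A B) (\<lambda>x. pure K A B (\<alpha> x) \<one>\<^bsub>B\<^esub>) (\<lambda>y. pure K A B \<one>\<^bsub>A\<^esub> (\<beta> y)) t"
    and "commuting_homs K A0 Y (tensor K A B)
      (\<lambda>x. pure K A B (\<alpha> x) \<one>\<^bsub>B\<^esub>) (\<lambda>y. pure K A B \<one>\<^bsub>A\<^esub> (\<beta> y))"
proof -
  interpret f: alg_hom K A0 A \<alpha> by fact
  interpret g: alg_hom K Y B \<beta> by fact
  interpret A: nc_algebra K A by (rule f.cod)
  interpret B: nc_algebra K B by (rule g.cod)
  interpret T: tensor_algebra K A B by (rule tensor_algebra.intro[OF f.cod g.cod])
  show c: "commuting_homs K A0 Y (tensor K A B)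
      (\<lambda>x. pure K A B (\<alpha> x) \<one>\<^bsub>B\<^esub>) (\<lambda>y. pure K A B \<one>\<^bsub>A\<^esub> (\<beta> y))"
    by (rule commuting_homs_comp_left[OF assms(1) commuting_homs_comp_right[OF assms(2) T.inl_inr_commuting]])
  show "tensor_map K A0 Y A B \<alpha> \<beta> t =
      copair K A0 Y (tensor K A B) (\<lambda>x. pure K A B (\<alpha> x) \<one>\<^bsub>B\<^esub>) (\<lambda>y. pure K A B \<one>\<^bsub>A\<^esub> (\<beta> y)) t"
    unfolding tensor_map_def using assms(3)
    by (rule commuting_homs.lift_eq_copair[OF c]) (simp add: T.tensor_mult_pure)
qed

lemma tensor_flip_eq_copair:
  assumes "tensor_algebra K A B" "t \<in> carrier (tensor K A B)"
  shows "tensor_flip K A B t = copair K A B (tensor K B A)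
    (\<lambda>a. pure K B A \<one>\<^bsub>B\<^esub> a) (\<lambda>b. pure K B A b \<one>\<^bsub>A\<^esub>) t"
proof -
  interpret ab: tensor_algebra K A B by fact
  interpret A: nc_algebra K A by (rule ab.left_algebra)
  interpret B: nc_algebra K B by (rule ab.right_algebra)
  interpret ba: tensor_algebra K B A by (intro tensor_algebra.intro ab.left_algebra ab.right_algebra)
  show ?thesis
    unfolding tensor_flip_def using assms(2)
    by (rule commuting_homs.lift_eq_copair[OF commuting_homs_sym[OF ba.inl_inr_commuting]])
       (simp add: ba.tensor_mult_pure)
qed

lemma tensor_map_closed:
  assumes "alg_hom K A0 A \<alpha>" "alg_hom K Y B \<beta>" "t \<in> carrier (tensor K A0 Y)"
  shows "tensor_map K A0 Y A B \<alpha> \<beta> t \<in> carrier (tensor K A B)"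
  using commuting_homs.copair_closed[OF tensor_map_eq_copair(2)[OF assms] assms(3)]
  by (simp add: tensor_map_eq_copair(1)[OF assms])

section \<open>Threefold tensor products\<close>

locale triple =
  fixes K :: "('k, 'r) ring_scheme" and A1 :: "('k, 'a, 'm) module_scheme"
    and A2 :: "('k, 'b, 'n) module_scheme" and A3 :: "('k, 'c, 'o) module_scheme"
  assumes nc1: "nc_algebra K A1" and nc2: "nc_algebra K A2" and nc3: "nc_algebra K A3"
begin

abbreviation "in1 \<equiv> \<lambda>a. pure3 K A1 A2 A3 a \<one>\<^bsub>A2\<^esub> \<one>\<^bsub>A3\<^esub>"
abbreviation "in2 \<equiv> \<lambda>b. pure3 K A1 A2 A3 \<one>\<^bsub>A1\<^esub> b \<one>\<^bsub>A3\<^esub>"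
abbreviation "in3 \<equiv> \<lambda>c. pure3 K A1 A2 A3 \<one>\<^bsub>A1\<^esub> \<one>\<^bsub>A2\<^esub> c"

lemma tensor_algebra_23: "tensor_algebra K A2 A3"
  by (intro tensor_algebra.intro nc2 nc3)

lemma tensor_algebra_1_23: "tensor_algebra K A1 (tensor K A2 A3)"
  by (intro tensor_algebra.intro nc1 tensor_algebra.tensor_nc_algebra[OF tensor_algebra_23])

end

locale three_homs =
  c12: commuting_homs K A1 A2 D \<alpha>1 \<alpha>2 + c13: commuting_homs K A1 A3 D \<alpha>1 \<alpha>3 +
  c23: commuting_homs K A2 A3 D \<alpha>2 \<alpha>3 for K A1 A2 A3 D \<alpha>1 \<alpha>2 \<alpha>3
begin

abbreviation "copair3 \<equiv> copair K A1 (tensor K A2 A3) D \<alpha>1 (copair K A2 A3 D \<alpha>2 \<alpha>3)"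

lemma commuting_1_23: "commuting_homs K A1 (tensor K A2 A3) D \<alpha>1 (copair K A2 A3 D \<alpha>2 \<alpha>3)"
  by (intro commuting_homs_copair_right c12.commuting_homs_axioms c13.commuting_homs_axioms
      c23.commuting_homs_axioms)

lemma commuting_12_3: "commuting_homs K (tensor K A1 A2) A3 D (copair K A1 A2 D \<alpha>1 \<alpha>2) \<alpha>3"
  by (intro commuting_homs_copair_left c12.commuting_homs_axioms c13.commuting_homs_axioms
      c23.commuting_homs_axioms)

lemma triple: "triple K A1 A2 A3"
  by (intro triple.intro c12.f.dom c12.g.dom c13.g.dom)

interpretation A1: nc_algebra K A1 by (rule c12.f.dom)
interpretation A2: nc_algebra K A2 by (rule c12.g.dom)
interpretation A3: nc_algebra K A3 by (rule c13.g.dom)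
interpretation D: nc_algebra K D by (rule c12.f.cod)

lemma
  shows copair3_in1: "a \<in> carrier A1 \<Longrightarrow> copair3 (pure3 K A1 A2 A3 a \<one>\<^bsub>A2\<^esub> \<one>\<^bsub>A3\<^esub>) = \<alpha>1 a"
    and copair3_in2: "b \<in> carrier A2 \<Longrightarrow> copair3 (pure3 K A1 A2 A3 \<one>\<^bsub>A1\<^esub> b \<one>\<^bsub>A3\<^esub>) = \<alpha>2 b"
    and copair3_in3: "c \<in> carrier A3 \<Longrightarrow> copair3 (pure3 K A1 A2 A3 \<one>\<^bsub>A1\<^esub> \<one>\<^bsub>A2\<^esub> c) = \<alpha>3 c"
  by (simp_all add: commuting_homs.copair_pure[OF commuting_1_23] c23.copair_pure
      c12.f.one c12.g.one c13.g.one)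

end

context triple
begin

interpretation A1: nc_algebra K A1 by (rule nc1)
interpretation A2: nc_algebra K A2 by (rule nc2)
interpretation A3: nc_algebra K A3 by (rule nc3)
interpretation T23: tensor_algebra K A2 A3 by (rule tensor_algebra_23)
interpretation T: tensor_algebra K A1 "tensor K A2 A3" by (rule tensor_algebra_1_23)
interpretation E: nc_algebra K "tensor3 K A1 A2 A3" by (rule T.tensor_nc_algebra)

lemma three_homs_in: "three_homs K A1 A2 A3 (tensor3 K A1 A2 A3) in1 in2 in3"
proof -
  note c = T.inl_inr_commuting[unfolded tensor_one]
  show ?thesis
    by (intro three_homs.intro commuting_homs_comp_right[OF T23.inl_hom c]
        commuting_homs_comp_right[OF T23.inr_hom c]
        commuting_homs.commuting_homs_comp[OF T23.inl_inr_commuting T.inr_hom])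
qed

interpretation can: three_homs K A1 A2 A3 "tensor3 K A1 A2 A3" in1 in2 in3
  by (rule three_homs_in)

interpretation j3: commuting_homs K A1 "tensor K A2 A3" "tensor3 K A1 A2 A3" in1
    "copair K A2 A3 (tensor3 K A1 A2 A3) in2 in3"
  by (rule can.commuting_1_23)

lemma hom3_eqI:
  assumes f: "alg_hom K (tensor3 K A1 A2 A3) D f" and g: "alg_hom K (tensor3 K A1 A2 A3) D g"
    and "\<And>a. a \<in> carrier A1 \<Longrightarrow> f (in1 a) = g (in1 a)"
    and "\<And>b. b \<in> carrier A2 \<Longrightarrow> f (in2 b) = g (in2 b)"
    and "\<And>c. c \<in> carrier A3 \<Longrightarrow> f (in3 c) = g (in3 c)"
    and "t \<in> carrier (tensor3 K A1 A2 A3)"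
  shows "f t = g t"
  using f g _ _ assms(6)
proof (rule T.hom_eqI)
  show "f (pure K A1 (tensor K A2 A3) a \<one>\<^bsub>tensor K A2 A3\<^esub>) = g (pure K A1 (tensor K A2 A3) a \<one>\<^bsub>tensor K A2 A3\<^esub>)"
    if "a \<in> carrier A1" for a
    using assms(3)[OF that] by (simp add: tensor_one)
  show "f (pure K A1 (tensor K A2 A3) \<one>\<^bsub>A1\<^esub> s) = g (pure K A1 (tensor K A2 A3) \<one>\<^bsub>A1\<^esub> s)"
    if "s \<in> carrier (tensor K A2 A3)" for s
    by (rule T23.hom_eqI[OF alg_hom_comp[OF T.inr_hom f] alg_hom_comp[OF T.inr_hom g] _ _ that])
       (use assms(4,5) in auto)
qed

text \<open>With the three inclusions into the tensor product itself, the induced map is the identity. So the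
rules below for arbitrary \<open>D\<close> also compute the leg maps and \<open>\<Delta> \<otimes> id\<close>, \<open>id \<otimes> \<Delta>\<close> themselves.\<close>

lemma copair3_in:
  assumes "t \<in> carrier (tensor3 K A1 A2 A3)"
  shows "can.copair3 t = t"
  by (rule hom3_eqI[OF j3.copair_hom alg_hom_id[OF T.tensor_nc_algebra] _ _ _ assms])
     (simp_all add: can.copair3_in1 can.copair3_in2 can.copair3_in3)

lemma leg12_eq_copair:
  "t \<in> carrier (tensor K A1 A2) \<Longrightarrow> leg12 K A1 A2 A3 t = copair K A1 A2 (tensor3 K A1 A2 A3) in1 in2 t"
  unfolding leg12_def
  by (rule can.c12.lift_eq_copair) (simp_all add: T.tensor_mult_pure T23.tensor_mult_pure)

lemma leg13_eq_copair:
  "t \<in> carrier (tensor K A1 A3) \<Longrightarrow> leg13 K A1 A2 A3 t = copair K A1 A3 (tensor3 K A1 A2 A3) in1 in3 t"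
  unfolding leg13_def
  by (rule can.c13.lift_eq_copair) (simp_all add: T.tensor_mult_pure T23.tensor_mult_pure)

lemma leg23_eq_copair:
  "t \<in> carrier (tensor K A2 A3) \<Longrightarrow> leg23 K A1 A2 A3 t = copair K A2 A3 (tensor3 K A1 A2 A3) in2 in3 t"
  unfolding leg23_def
  by (rule can.c23.lift_eq_copair) (simp_all add: T.tensor_mult_pure T23.tensor_mult_pure)

lemma leg12_closed: "t \<in> carrier (tensor K A1 A2) \<Longrightarrow> leg12 K A1 A2 A3 t \<in> carrier (tensor3 K A1 A2 A3)"
  by (simp add: leg12_eq_copair can.c12.copair_closed)

lemma leg13_closed: "t \<in> carrier (tensor K A1 A3) \<Longrightarrow> leg13 K A1 A2 A3 t \<in> carrier (tensor3 K A1 A2 A3)"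
  by (simp add: leg13_eq_copair can.c13.copair_closed)

lemma leg23_closed: "t \<in> carrier (tensor K A2 A3) \<Longrightarrow> leg23 K A1 A2 A3 t \<in> carrier (tensor3 K A1 A2 A3)"
  by (simp add: leg23_eq_copair can.c23.copair_closed)

lemma tensor_assoc_eq_copair:
  assumes "t \<in> carrier (tensor K (tensor K A1 A2) A3)"
  shows "tensor_assoc K A1 A2 A3 t = copair K (tensor K A1 A2) A3 (tensor3 K A1 A2 A3)
    (copair K A1 A2 (tensor3 K A1 A2 A3) in1 in2) in3 t"
  unfolding tensor_assoc_def using assms
proof (rule commuting_homs.lift_eq_copair[OF can.commuting_12_3])
  fix x c assume x: "x \<in> carrier (tensor K A1 A2)" and c: "c \<in> carrier A3"
  let ?E = "tensor3 K A1 A2 A3"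
  have bal: "balanced K A1 A2 ?E (\<lambda>a b. pure3 K A1 A2 A3 a b c)"
    unfolding balanced_def using c
    by (auto simp: T.pure_add_l T.pure_add_r T23.pure_add_l T.pure_smult
        T23.tensor_smult_pure)
  note l = can.c12.tensor_lift_pure[OF T.tensor_abelian_group bal]
    can.c12.tensor_lift_add[OF T.tensor_abelian_group bal]
  show "tensor_lift K A1 A2 ?E (\<lambda>a b. pure3 K A1 A2 A3 a b c) x =
    copair K A1 A2 ?E in1 in2 x \<otimes>\<^bsub>?E\<^esub> in3 c"
    using x
    by (induction x rule: can.c12.tensor_induct)
       (use c in \<open>simp_all add: l can.c12.copair_pure can.c12.copair_add T.tensor_mult_pure
         T23.tensor_mult_pure E.l_distr\<close>)
qed

lemma assoc_map_closed:
  assumes "alg_hom K A0 (tensor K A1 A2) \<Delta>" "t \<in> carrier (tensor K A0 A3)"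
  shows "tensor_assoc K A1 A2 A3 (tensor_map K A0 A3 (tensor K A1 A2) A3 \<Delta> (\<lambda>c. c) t)
    \<in> carrier (tensor3 K A1 A2 A3)"
  using tensor_map_closed[OF assms(1) alg_hom_id[OF nc3] assms(2)]
  by (simp add: tensor_assoc_eq_copair commuting_homs.copair_closed[OF can.commuting_12_3])

end

context three_homs
begin

interpretation t: triple K A1 A2 A3 by (rule triple)
interpretation can: three_homs K A1 A2 A3 "tensor3 K A1 A2 A3" t.in1 t.in2 t.in3
  by (rule t.three_homs_in)
interpretation j3: commuting_homs K A1 "tensor K A2 A3" D \<alpha>1 "copair K A2 A3 D \<alpha>2 \<alpha>3"
  by (rule commuting_1_23)

lemma copair3_leg12: "t \<in> carrier (tensor K A1 A2) \<Longrightarrow> copair3 (leg12 K A1 A2 A3 t) = copair K A1 A2 D \<alpha>1 \<alpha>2 t"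
  by (simp add: t.leg12_eq_copair can.c12.copair_comp[OF j3.copair_hom])
     (rule c12.copair_cong; simp add: copair3_in1 copair3_in2)

lemma copair3_leg13: "t \<in> carrier (tensor K A1 A3) \<Longrightarrow> copair3 (leg13 K A1 A2 A3 t) = copair K A1 A3 D \<alpha>1 \<alpha>3 t"
  by (simp add: t.leg13_eq_copair can.c13.copair_comp[OF j3.copair_hom])
     (rule c13.copair_cong; simp add: copair3_in1 copair3_in3)

lemma copair3_leg23: "t \<in> carrier (tensor K A2 A3) \<Longrightarrow> copair3 (leg23 K A1 A2 A3 t) = copair K A2 A3 D \<alpha>2 \<alpha>3 t"
  by (simp add: t.leg23_eq_copair can.c23.copair_comp[OF j3.copair_hom])
     (rule c23.copair_cong; simp add: copair3_in2 copair3_in3)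

text \<open>In \<open>D\<close>, applying \<open>\<Delta>\<close> to the first factor amounts to replacing the homomorphism on this factor by
\<open>copair \<circ> \<Delta>\<close>. With this rule and the ones for the legs, an identity about \<open>\<Delta>\<close> in the
threefold tensor product becomes one in \<open>D\<close>, without a trace of the bracketing.\<close>

lemma copair3_map_left:
  assumes d: "alg_hom K A0 (tensor K A1 A2) \<Delta>" and t: "t \<in> carrier (tensor K A0 A3)"
  shows "copair3 (tensor_assoc K A1 A2 A3 (tensor_map K A0 A3 (tensor K A1 A2) A3 \<Delta> (\<lambda>c. c) t)) =
    copair K A0 A3 D (\<lambda>x. copair K A1 A2 D \<alpha>1 \<alpha>2 (\<Delta> x)) \<alpha>3 t"
proof -
  interpret d: alg_hom K A0 "tensor K A1 A2" \<Delta> by fact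
  interpret a: commuting_homs K "tensor K A1 A2" A3 "tensor3 K A1 A2 A3"
    "copair K A1 A2 (tensor3 K A1 A2 A3) t.in1 t.in2" t.in3
    by (rule can.commuting_12_3)
  let ?f = "\<lambda>x. pure K (tensor K A1 A2) A3 (\<Delta> x) \<one>\<^bsub>A3\<^esub>"
    and ?g = "\<lambda>c. pure K (tensor K A1 A2) A3 \<one>\<^bsub>tensor K A1 A2\<^esub> c"
  note id = alg_hom_id[OF t.nc3]
  interpret m: commuting_homs K A0 A3 "tensor K (tensor K A1 A2) A3" ?f ?g
    using tensor_map_eq_copair(2)[OF d id t] .
  interpret r: commuting_homs K A0 A3 D "\<lambda>x. copair K A1 A2 D \<alpha>1 \<alpha>2 (\<Delta> x)" \<alpha>3
    by (rule commuting_homs_comp_left[OF d commuting_12_3])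
  have h: "alg_hom K (tensor K (tensor K A1 A2) A3) D (\<lambda>u. copair3 (copair K (tensor K A1 A2) A3 (tensor3 K A1 A2 A3)
      (copair K A1 A2 (tensor3 K A1 A2 A3) t.in1 t.in2) t.in3 u))"
    by (rule alg_hom_comp[OF a.copair_hom j3.copair_hom])
  have 1: "copair3 (copair K A1 A2 (tensor3 K A1 A2 A3) t.in1 t.in2 y) = copair K A1 A2 D \<alpha>1 \<alpha>2 y"
    if "y \<in> carrier (tensor K A1 A2)" for y
    using copair3_leg12[OF that] that by (simp add: t.leg12_eq_copair)
  show ?thesis
    using t
    by (simp add: tensor_map_eq_copair[OF d id] t.tensor_assoc_eq_copair m.copair_comp[OF h])
       (rule r.copair_cong; simp add: a.copair_inl a.copair_inr 1 copair3_in3)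
qed

lemma copair3_map_right:
  assumes d: "alg_hom K A0 (tensor K A2 A3) \<Delta>" and t: "t \<in> carrier (tensor K A1 A0)"
  shows "copair3 (tensor_map K A1 A0 A1 (tensor K A2 A3) (\<lambda>a. a) \<Delta> t) =
    copair K A1 A0 D \<alpha>1 (\<lambda>x. copair K A2 A3 D \<alpha>2 \<alpha>3 (\<Delta> x)) t"
proof -
  interpret d: alg_hom K A0 "tensor K A2 A3" \<Delta> by fact
  let ?f = "\<lambda>a. pure K A1 (tensor K A2 A3) a \<one>\<^bsub>tensor K A2 A3\<^esub>"
    and ?g = "\<lambda>x. pure K A1 (tensor K A2 A3) \<one>\<^bsub>A1\<^esub> (\<Delta> x)"
  note id = alg_hom_id[OF t.nc1]
  interpret m: commuting_homs K A1 A0 "tensor3 K A1 A2 A3" ?f ?g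
    using tensor_map_eq_copair(2)[OF id d t] .
  interpret r: commuting_homs K A1 A0 D \<alpha>1 "\<lambda>x. copair K A2 A3 D \<alpha>2 \<alpha>3 (\<Delta> x)"
    by (rule commuting_homs_comp_right[OF d commuting_1_23])
  show ?thesis
    using t
    by (simp add: tensor_map_eq_copair[OF id d] m.copair_comp[OF j3.copair_hom])
       (rule r.copair_cong; simp add: j3.copair_inl j3.copair_inr)
qed

end

section \<open>Conjugation by a unit\<close>

definition conjugate :: "('a, 'm) monoid_scheme \<Rightarrow> 'a \<Rightarrow> 'a \<Rightarrow> 'a"
  where "conjugate G u x = u \<otimes>\<^bsub>G\<^esub> x \<otimes>\<^bsub>G\<^esub> inv\<^bsub>G\<^esub> u"

context monoid
begin

lemma conjugate_commuting:
  assumes "u \<in> Units G" "x \<in> carrier G" "u \<otimes> x = x \<otimes> u"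
  shows "conjugate G u x = x"
  unfolding conjugate_def using assms by (simp add: m_assoc Units_closed)

lemma inv_mult_Units:
  assumes "u \<in> Units G" "v \<in> Units G"
  shows "inv (u \<otimes> v) = inv v \<otimes> inv u"
proof (rule inv_unique'[symmetric])
  have "u \<otimes> (v \<otimes> inv v) \<otimes> inv u = \<one>" "inv v \<otimes> (inv u \<otimes> u) \<otimes> v = \<one>"
    using assms by (simp_all add: Units_closed)
  then show "u \<otimes> v \<otimes> (inv v \<otimes> inv u) = \<one>" "inv v \<otimes> inv u \<otimes> (u \<otimes> v) = \<one>"
    using assms by (simp_all only: m_assoc Units_closed Units_inv_closed m_closed)
qed (use assms in \<open>simp_all add: Units_closed\<close>)

lemma conjugate_conjugate:
  assumes "u \<in> Units G" "v \<in> Units G" "x \<in> carrier G"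
  shows "conjugate G u (conjugate G v x) = conjugate G (u \<otimes> v) x"
  unfolding conjugate_def using assms by (simp add: m_assoc inv_mult_Units Units_closed)

lemma conjugate_mult:
  assumes "u \<in> Units G" "x \<in> carrier G" "y \<in> carrier G"
  shows "conjugate G u (x \<otimes> y) = conjugate G u x \<otimes> conjugate G u y"
proof -
  have "conjugate G u x \<otimes> conjugate G u y = u \<otimes> x \<otimes> (inv u \<otimes> u) \<otimes> y \<otimes> inv u"
    unfolding conjugate_def
    using assms by (simp only: m_assoc Units_closed Units_inv_closed m_closed)
  then show ?thesis using assms by (simp add: conjugate_def m_assoc Units_closed)
qed

lemma left_commute:
  assumes "x \<otimes> y = y \<otimes> x" "x \<in> carrier G" "y \<in> carrier G" "z \<in> carrier G"
  shows "x \<otimes> (y \<otimes> z) = y \<otimes> (x \<otimes> z)"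
  using assms by (simp flip: m_assoc)

lemma commute_inv:
  assumes "x \<otimes> u = u \<otimes> x" "x \<in> carrier G" "u \<in> Units G"
  shows "x \<otimes> inv u = inv u \<otimes> x"
proof -
  have "inv u \<otimes> x = inv u \<otimes> (x \<otimes> u) \<otimes> inv u"
    using assms(2,3) by (simp add: m_assoc Units_closed)
  also have "\<dots> = inv u \<otimes> u \<otimes> (x \<otimes> inv u)"
    unfolding assms(1) using assms(2,3) by (simp only: m_assoc Units_closed Units_inv_closed m_closed)
  also have "\<dots> = x \<otimes> inv u" using assms(2,3) by simp
  finally show ?thesis by simp
qed

lemma commute_mult_right:
  assumes "x \<otimes> y = y \<otimes> x" "x \<otimes> z = z \<otimes> x" "x \<in> carrier G" "y \<in> carrier G" "z \<in> carrier G"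
  shows "x \<otimes> (y \<otimes> z) = (y \<otimes> z) \<otimes> x"
  using assms left_commute[of x y z] by (simp add: m_assoc)

lemma commute_mult_left:
  assumes "x \<otimes> z = z \<otimes> x" "y \<otimes> z = z \<otimes> y" "x \<in> carrier G" "y \<in> carrier G" "z \<in> carrier G"
  shows "(x \<otimes> y) \<otimes> z = z \<otimes> (x \<otimes> y)"
  using assms by (intro commute_mult_right[symmetric]) simp_all

text \<open>Both conditions on the comultiplication come down to this identity. Here \<open>r\<close> is the twist. It commutes
with the outer factors \<open>s\<close>, \<open>a\<close>, \<open>d\<close>, \<open>u\<close>, so only \<open>t c b v\<inverse>\<close> has to be conjugated, and the two
hypotheses of Yang-Baxter type carry \<open>r\<close> past \<open>t c\<close> from the left and \<open>r\<inverse>\<close> past \<open>b v\<inverse>\<close>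
from the right, where they meet and cancel.\<close>

lemma conjugate_regroup:
  assumes units: "r \<in> Units G" "u \<in> Units G" "v \<in> Units G"
    and carr: "s \<in> carrier G" "t \<in> carrier G" "a \<in> carrier G" "b \<in> carrier G" "c \<in> carrier G" "d \<in> carrier G"
    and r: "r \<otimes> s = s \<otimes> r" "r \<otimes> a = a \<otimes> r" "d \<otimes> r = r \<otimes> d" "u \<otimes> r = r \<otimes> u"
    and t: "t \<otimes> a = a \<otimes> t" "t \<otimes> v = v \<otimes> t"
    and b: "b \<otimes> c = c \<otimes> b" and d: "d \<otimes> v = v \<otimes> d"
    and ybc: "c \<otimes> (t \<otimes> r) = r \<otimes> t \<otimes> c" and ybb: "b \<otimes> (r \<otimes> v) = v \<otimes> r \<otimes> b"
  shows "conjugate G r ((s \<otimes> t) \<otimes> (a \<otimes> b) \<otimes> (c \<otimes> d) \<otimes> inv (u \<otimes> v)) =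
    (s \<otimes> a \<otimes> c \<otimes> inv v) \<otimes> (t \<otimes> b \<otimes> d \<otimes> inv u)"
proof -
  note carr' = carr units[THEN Units_closed] units[THEN Units_inv_closed]
  have b_rv: "b \<otimes> (inv v \<otimes> inv r) = inv r \<otimes> (inv v \<otimes> b)"
  proof -
    have rv: "r \<otimes> v \<in> Units G" "v \<otimes> r \<in> Units G" using units by simp_all
    have "inv (v \<otimes> r) \<otimes> b = inv (v \<otimes> r) \<otimes> (b \<otimes> (r \<otimes> v)) \<otimes> inv (r \<otimes> v)"
      using rv carr' by (simp add: m_assoc)
    also have "\<dots> = b \<otimes> inv (r \<otimes> v)"
      using rv(2)[THEN Units_l_inv] rv(1)[THEN Units_inv_closed] rv(2)[THEN Units_inv_closed] carr'
      unfolding ybb by (metis m_assoc m_closed l_one)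
    finally show ?thesis using units carr' by (simp add: inv_mult_Units m_assoc)
  qed
  have "conjugate G r ((s \<otimes> t) \<otimes> (a \<otimes> b) \<otimes> (c \<otimes> d) \<otimes> inv (u \<otimes> v)) =
      r \<otimes> (s \<otimes> (t \<otimes> (a \<otimes> (b \<otimes> (c \<otimes> (d \<otimes> (inv v \<otimes> (inv u \<otimes> inv r))))))))"
    unfolding conjugate_def inv_mult_Units[OF units(2,3)] using carr' by (simp add: m_assoc)
  also have "inv u \<otimes> inv r = inv r \<otimes> inv u"
    using units r(4) by (metis inv_mult_Units)
  also have "d \<otimes> (inv v \<otimes> (inv r \<otimes> inv u)) = inv v \<otimes> (inv r \<otimes> (d \<otimes> inv u))"
    using carr' units r(3) d by (simp add: left_commute commute_inv)
  also have "b \<otimes> (c \<otimes> (inv v \<otimes> (inv r \<otimes> (d \<otimes> inv u)))) = c \<otimes> (b \<otimes> (inv v \<otimes> inv r) \<otimes> (d \<otimes> inv u))"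
    using carr' by (simp add: left_commute[OF b] m_assoc)
  also have "\<dots> = c \<otimes> (inv r \<otimes> (inv v \<otimes> (b \<otimes> (d \<otimes> inv u))))"
    unfolding b_rv using carr' by (simp add: m_assoc)
  also have "t \<otimes> (a \<otimes> (c \<otimes> (inv r \<otimes> (inv v \<otimes> (b \<otimes> (d \<otimes> inv u)))))) =
      a \<otimes> (t \<otimes> (c \<otimes> (inv r \<otimes> (inv v \<otimes> (b \<otimes> (d \<otimes> inv u))))))"
    using carr' by (simp add: left_commute[OF t(1)])
  also have "r \<otimes> (s \<otimes> (a \<otimes> (t \<otimes> (c \<otimes> (inv r \<otimes> (inv v \<otimes> (b \<otimes> (d \<otimes> inv u)))))))) =
      s \<otimes> (a \<otimes> ((r \<otimes> t \<otimes> c) \<otimes> (inv r \<otimes> (inv v \<otimes> (b \<otimes> (d \<otimes> inv u))))))"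
    using carr' by (simp add: left_commute[OF r(1)] left_commute[OF r(2)] m_assoc)
  also have "\<dots> = s \<otimes> (a \<otimes> (c \<otimes> (t \<otimes> (r \<otimes> inv r) \<otimes> (inv v \<otimes> (b \<otimes> (d \<otimes> inv u))))))"
    unfolding ybc[symmetric] using carr' by (simp only: m_assoc m_closed)
  also have "\<dots> = s \<otimes> (a \<otimes> (c \<otimes> (inv v \<otimes> (t \<otimes> (b \<otimes> (d \<otimes> inv u))))))"
    using carr' units t(2) by (simp add: left_commute commute_inv)
  also have "\<dots> = (s \<otimes> a \<otimes> c \<otimes> inv v) \<otimes> (t \<otimes> b \<otimes> d \<otimes> inv u)"
    using carr' by (simp add: m_assoc)
  finally show ?thesis .
qed

end

lemma conjugate_alg_hom:
  assumes "nc_algebra K D" "u \<in> Units D"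
  shows "alg_hom K D D (conjugate D u)"
proof -
  interpret nc_algebra K D by fact
  have u: "u \<in> carrier D" "inv\<^bsub>D\<^esub> u \<in> carrier D" using assms by auto
  show ?thesis
  proof (rule alg_homI)
    show "conjugate D u (x \<otimes>\<^bsub>D\<^esub> y) = conjugate D u x \<otimes>\<^bsub>D\<^esub> conjugate D u y"
      if "x \<in> carrier D" "y \<in> carrier D" for x y
      using assms(2) that by (rule conjugate_mult)
  qed (use assms u in \<open>simp_all add: conjugate_def l_distr r_distr smult_mult_l smult_mult_r\<close>)
qed

lemma (in alg_hom) conjugate:
  assumes "u \<in> Units A" "x \<in> carrier A"
  shows "\<alpha> (conjugate A u x) = conjugate D (\<alpha> u) (\<alpha> x)"
proof -
  interpret A: nc_algebra K A by (rule dom)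
  show ?thesis
    using assms by (simp add: conjugate_def mult inverse A.Units_closed)
qed

section \<open>The fourfold tensor product\<close>

lemma commuting_homs_inl_inr_comp:
  assumes "nc_algebra K A" "nc_algebra K B" "alg_hom K (tensor K A B) D \<theta>"
  shows "commuting_homs K A B D (\<lambda>a. \<theta> (pure K A B a \<one>\<^bsub>B\<^esub>)) (\<lambda>b. \<theta> (pure K A B \<one>\<^bsub>A\<^esub> b))"
  by (intro commuting_homs.commuting_homs_comp[OF tensor_algebra.inl_inr_commuting assms(3)]
      tensor_algebra.intro assms(1,2))

locale algebra_pair =
  fixes K :: "('k, 'r) ring_scheme" and B :: "('k, 'b, 'm) module_scheme"
    and C :: "('k, 'c, 'n) module_scheme"
  assumes algebra_B: "nc_algebra K B" and algebra_C: "nc_algebra K C"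
begin

abbreviation "BC \<equiv> tensor K B C"
abbreviation "inB b \<equiv> pure K B C b \<one>\<^bsub>C\<^esub>"
abbreviation "inC c \<equiv> pure K B C \<one>\<^bsub>B\<^esub> c"

lemma tensor_algebra_BC: "tensor_algebra K B C"
  by (intro tensor_algebra.intro algebra_B algebra_C)

lemma algebra_BC: "nc_algebra K BC"
  by (rule tensor_algebra.tensor_nc_algebra[OF tensor_algebra_BC])

lemma algebra_BCBC: "nc_algebra K (tensor_BCBC K B C)"
  by (intro tensor_algebra.tensor_nc_algebra tensor_algebra.intro algebra_BC)

lemma inB_hom: "alg_hom K B BC inB"
  by (rule tensor_algebra.inl_hom[OF tensor_algebra_BC])

lemma inC_hom: "alg_hom K C BC inC"
  by (rule tensor_algebra.inr_hom[OF tensor_algebra_BC])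

abbreviation "left z \<equiv> pure K BC BC z \<one>\<^bsub>BC\<^esub>"
abbreviation "right z \<equiv> pure K BC BC \<one>\<^bsub>BC\<^esub> z"

lemma tensor_algebra_BCBC: "tensor_algebra K BC BC"
  by (intro tensor_algebra.intro algebra_BC)

lemma commuting_left_right: "commuting_homs K BC BC (tensor_BCBC K B C) left right"
  by (rule tensor_algebra.inl_inr_commuting[OF tensor_algebra_BCBC])

context
  fixes g1 g2 D
  assumes g: "commuting_homs K BC BC D g1 g2"
begin

lemma commuting_BB: "commuting_homs K B B D (\<lambda>x. g1 (inB x)) (\<lambda>x. g2 (inB x))"
  and commuting_CC: "commuting_homs K C C D (\<lambda>y. g1 (inC y)) (\<lambda>y. g2 (inC y))"
  and commuting_CB: "commuting_homs K C B D (\<lambda>y. g1 (inC y)) (\<lambda>x. g2 (inB x))"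
  and commuting_BC: "commuting_homs K B C D (\<lambda>x. g1 (inB x)) (\<lambda>y. g2 (inC y))"
  by (intro commuting_homs_comp_left[OF inB_hom] commuting_homs_comp_left[OF inC_hom]
      commuting_homs_comp_right[OF inB_hom] commuting_homs_comp_right[OF inC_hom] g)+

end

lemma
  shows bb13_eq_copair: "t \<in> carrier (tensor K B B) \<Longrightarrow> bb13 K B C t =
      copair K B B (tensor_BCBC K B C) (\<lambda>x. left (inB x)) (\<lambda>x. right (inB x)) t"
    and cc24_eq_copair: "u \<in> carrier (tensor K C C) \<Longrightarrow> cc24 K B C u =
      copair K C C (tensor_BCBC K B C) (\<lambda>y. left (inC y)) (\<lambda>y. right (inC y)) u"
    and cb23_eq_copair: "v \<in> carrier (tensor K C B) \<Longrightarrow> cb23 K B C v =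
      copair K C B (tensor_BCBC K B C) (\<lambda>y. left (inC y)) (\<lambda>x. right (inB x)) v"
    and cb41_eq_copair: "v \<in> carrier (tensor K C B) \<Longrightarrow> cb41 K B C v =
      copair K C B (tensor_BCBC K B C) (\<lambda>y. right (inC y)) (\<lambda>x. left (inB x)) v"
proof -
  interpret B: nc_algebra K B by (rule algebra_B)
  interpret C: nc_algebra K C by (rule algebra_C)
  interpret BC: nc_algebra K BC by (rule algebra_BC)
  interpret t: tensor_algebra K B C by (rule tensor_algebra_BC)
  interpret T: tensor_algebra K BC BC by (rule tensor_algebra_BCBC)
  note [simp] = T.tensor_mult_pure t.tensor_mult_pure tensor_one
  note c = commuting_left_right
  show "t \<in> carrier (tensor K B B) \<Longrightarrow> bb13 K B C t =
      copair K B B (tensor_BCBC K B C) (\<lambda>x. left (inB x)) (\<lambda>x. right (inB x)) t"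
    unfolding bb13_def by (rule commuting_homs.lift_eq_copair[OF commuting_BB[OF c]]) simp_all
  show "u \<in> carrier (tensor K C C) \<Longrightarrow> cc24 K B C u =
      copair K C C (tensor_BCBC K B C) (\<lambda>y. left (inC y)) (\<lambda>y. right (inC y)) u"
    unfolding cc24_def by (rule commuting_homs.lift_eq_copair[OF commuting_CC[OF c]]) simp_all
  show "v \<in> carrier (tensor K C B) \<Longrightarrow> cb23 K B C v =
      copair K C B (tensor_BCBC K B C) (\<lambda>y. left (inC y)) (\<lambda>x. right (inB x)) v"
    unfolding cb23_def by (rule commuting_homs.lift_eq_copair[OF commuting_CB[OF c]]) simp_all
  show "v \<in> carrier (tensor K C B) \<Longrightarrow> cb41 K B C v =
      copair K C B (tensor_BCBC K B C) (\<lambda>y. right (inC y)) (\<lambda>x. left (inB x)) v"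
    unfolding cb41_def
    by (rule commuting_homs.lift_eq_copair[OF commuting_homs_sym[OF commuting_BC[OF c]]]) simp_all
qed

text \<open>A homomorphism out of \<open>(B \<otimes> C) \<otimes> (B \<otimes> C)\<close> only sees the restrictions of \<open>g1\<close> and \<open>g2\<close> to \<open>B\<close> and
to \<open>C\<close>. In \<open>cb41\<close> the \<open>C\<close>-component is in the second copy, hence the exchange of \<open>g1\<close> and \<open>g2\<close>.\<close>

lemma
  assumes g: "commuting_homs K BC BC D g1 g2"
  shows copair_bb13: "t \<in> carrier (tensor K B B) \<Longrightarrow>
      copair K BC BC D g1 g2 (bb13 K B C t) = copair K B B D (\<lambda>x. g1 (inB x)) (\<lambda>x. g2 (inB x)) t"
    and copair_cc24: "u \<in> carrier (tensor K C C) \<Longrightarrow>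
      copair K BC BC D g1 g2 (cc24 K B C u) = copair K C C D (\<lambda>y. g1 (inC y)) (\<lambda>y. g2 (inC y)) u"
    and copair_cb23: "v \<in> carrier (tensor K C B) \<Longrightarrow>
      copair K BC BC D g1 g2 (cb23 K B C v) = copair K C B D (\<lambda>y. g1 (inC y)) (\<lambda>x. g2 (inB x)) v"
    and copair_cb41: "v \<in> carrier (tensor K C B) \<Longrightarrow>
      copair K BC BC D g1 g2 (cb41 K B C v) = copair K C B D (\<lambda>y. g2 (inC y)) (\<lambda>x. g1 (inB x)) v"
proof -
  interpret g: commuting_homs K BC BC D g1 g2 by fact
  note [simp] = g.copair_inl g.copair_inr alg_hom.closed[OF inB_hom] alg_hom.closed[OF inC_hom]
  note c = commuting_left_right
  show "copair K BC BC D g1 g2 (bb13 K B C t) = copair K B B D (\<lambda>x. g1 (inB x)) (\<lambda>x. g2 (inB x)) t"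
    if t: "t \<in> carrier (tensor K B B)" for t
    unfolding bb13_eq_copair[OF t] commuting_homs.copair_comp[OF commuting_BB[OF c] g.copair_hom t]
    by (rule commuting_homs.copair_cong[OF commuting_BB[OF g] _ _ t]) simp_all
  show "copair K BC BC D g1 g2 (cc24 K B C u) = copair K C C D (\<lambda>y. g1 (inC y)) (\<lambda>y. g2 (inC y)) u"
    if u: "u \<in> carrier (tensor K C C)" for u
    unfolding cc24_eq_copair[OF u] commuting_homs.copair_comp[OF commuting_CC[OF c] g.copair_hom u]
    by (rule commuting_homs.copair_cong[OF commuting_CC[OF g] _ _ u]) simp_all
  show "copair K BC BC D g1 g2 (cb23 K B C v) = copair K C B D (\<lambda>y. g1 (inC y)) (\<lambda>x. g2 (inB x)) v"
    if v: "v \<in> carrier (tensor K C B)" for v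
    unfolding cb23_eq_copair[OF v] commuting_homs.copair_comp[OF commuting_CB[OF c] g.copair_hom v]
    by (rule commuting_homs.copair_cong[OF commuting_CB[OF g] _ _ v]) simp_all
  show "copair K BC BC D g1 g2 (cb41 K B C v) = copair K C B D (\<lambda>y. g2 (inC y)) (\<lambda>x. g1 (inB x)) v"
    if v: "v \<in> carrier (tensor K C B)" for v
    unfolding cb41_eq_copair[OF v]
      commuting_homs.copair_comp[OF commuting_homs_sym[OF commuting_BC[OF c]] g.copair_hom v]
    by (rule commuting_homs.copair_cong[OF commuting_homs_sym[OF commuting_BC[OF g]] _ _ v]) simp_all
qed

end

section \<open>Commuting copies of \<open>B \<otimes> C\<close>\<close>

locale twist = algebra_pair K B C for K and B :: "('k, 'b) hopf" and C :: "('k, 'c) hopf" +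
  fixes R RB RC
  assumes comult_B: "alg_hom K B (tensor K B B) (comult B)"
    and comult_C: "alg_hom K C (tensor K C C) (comult C)"
    and R_Units: "R \<in> Units (tensor K C B)"
    and R_left: "tensor_assoc K C C B (tensor_map K C B (tensor K C C) B (comult C) (\<lambda>b. b) R) =
         leg23 K C C B R \<otimes>\<^bsub>tensor3 K C C B\<^esub> leg13 K C C B R"
    and R_right: "tensor_map K C B C (tensor K B B) (\<lambda>c. c) (comult B) R =
         leg12 K C B B R \<otimes>\<^bsub>tensor3 K C B B\<^esub> leg13 K C B B R"
    and qt_B: "quasi_triangular K B RB" and qt_C: "quasi_triangular K C RC"
begin

lemma R_carrier: "R \<in> carrier (tensor K C B)"
  using R_Units by (simp add: Units_def)

lemma RB_Units: "RB \<in> Units (tensor K B B)"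
  using qt_B by (simp add: quasi_triangular_def)

lemma RC_Units: "RC \<in> Units (tensor K C C)"
  using qt_C by (simp add: quasi_triangular_def)

lemma RB_left: "tensor_assoc K B B B (tensor_map K B B (tensor K B B) B (comult B) (\<lambda>y. y) RB) =
    leg13 K B B B RB \<otimes>\<^bsub>tensor3 K B B B\<^esub> leg23 K B B B RB"
  and RB_right: "tensor_map K B B B (tensor K B B) (\<lambda>y. y) (comult B) RB =
    leg13 K B B B RB \<otimes>\<^bsub>tensor3 K B B B\<^esub> leg12 K B B B RB"
  using qt_B by (simp_all add: quasi_triangular_def)

lemma RC_left: "tensor_assoc K C C C (tensor_map K C C (tensor K C C) C (comult C) (\<lambda>y. y) RC) =
    leg13 K C C C RC \<otimes>\<^bsub>tensor3 K C C C\<^esub> leg23 K C C C RC"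
  and RC_right: "tensor_map K C C C (tensor K C C) (\<lambda>y. y) (comult C) RC =
    leg13 K C C C RC \<otimes>\<^bsub>tensor3 K C C C\<^esub> leg12 K C C C RC"
  using qt_C by (simp_all add: quasi_triangular_def)

lemma RB_carrier: "RB \<in> carrier (tensor K B B)"
  using RB_Units by (simp add: Units_def)

lemma RC_carrier: "RC \<in> carrier (tensor K C C)"
  using RC_Units by (simp add: Units_def)

end

text \<open>An algebra \<open>D\<close> that receives copies of \<open>B \<otimes> C\<close>, indexed by \<open>I\<close>, with commuting images. The cases of interest are the
tensor products of two and of three copies, with \<open>I = {1, 2}\<close> and \<open>I = {1, 2, 3}\<close>.\<close>

locale positions = twist K B C R RB RC
  for K :: "('k, 'r) ring_scheme" and B :: "('k, 'b) hopf" and C :: "('k, 'c) hopf" and R RB RC +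
  fixes D :: "('k, 'd, 'l) module_scheme" and k :: "nat \<Rightarrow> ('b \<times> 'c \<Rightarrow>\<^sub>0 int) set \<Rightarrow> 'd" and I :: "nat set"
  assumes hom: "i \<in> I \<Longrightarrow> alg_hom K BC D (k i)"
    and commuting: "\<lbrakk>i \<in> I; j \<in> I; i \<noteq> j\<rbrakk> \<Longrightarrow> commuting_homs K BC BC D (k i) (k j)"
    and algebra_D: "nc_algebra K D"
begin

interpretation D: nc_algebra K D by (rule algebra_D)

text \<open>The index of \<open>b\<close> and \<open>c\<close> is a copy of \<open>B \<otimes> C\<close>, not a tensor factor: with two copies, \<open>r 1 2\<close> is
\<open>R\<^sub>2\<^sub>3\<close> and \<open>r 2 1\<close> is \<open>R\<^sub>4\<^sub>1\<close>, and \<open>p 1 2\<close>, \<open>q 1 2\<close> are \<open>R\<^sup>B\<^sub>1\<^sub>3\<close>, \<open>R\<^sup>C\<^sub>2\<^sub>4\<close>.\<close>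

definition "b i x = k i (inB x)"
definition "c i y = k i (inC y)"
definition "r i j = copair K C B D (c i) (b j) R"
definition "p i j = copair K B B D (b i) (b j) RB"
definition "q i j = copair K C C D (c i) (c j) RC"
definition "comultB i j x = copair K B B D (b i) (b j) (comult B x)"
definition "comultC i j y = copair K C C D (c i) (c j) (comult C y)"

lemma bb: "\<lbrakk>i \<in> I; j \<in> I; i \<noteq> j\<rbrakk> \<Longrightarrow> commuting_homs K B B D (b i) (b j)"
  unfolding b_def by (intro commuting_homs_comp_left[OF inB_hom] commuting_homs_comp_right[OF inB_hom] commuting)

lemma cc: "\<lbrakk>i \<in> I; j \<in> I; i \<noteq> j\<rbrakk> \<Longrightarrow> commuting_homs K C C D (c i) (c j)"
  unfolding c_def by (intro commuting_homs_comp_left[OF inC_hom] commuting_homs_comp_right[OF inC_hom] commuting)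

lemma bc: "\<lbrakk>i \<in> I; j \<in> I\<rbrakk> \<Longrightarrow> commuting_homs K B C D (b i) (c j)"
proof (cases "i = j")
  case True
  assume "i \<in> I"
  then show ?thesis
    unfolding b_def c_def True
    by (intro commuting_homs_inl_inr_comp hom algebra_B algebra_C) (simp add: True)
next
  case False
  assume "i \<in> I" "j \<in> I"
  then show ?thesis
    using False unfolding b_def c_def
    by (intro commuting_homs_comp_left[OF inB_hom] commuting_homs_comp_right[OF inC_hom] commuting)
qed

lemma cb: "\<lbrakk>i \<in> I; j \<in> I\<rbrakk> \<Longrightarrow> commuting_homs K C B D (c i) (b j)"
  by (rule commuting_homs_sym) (rule bc)

text \<open>Elements placed in disjoint sets of tensor factors commute. All commutation facts below rest on this.\<close>

lemmas cross = commuting_homs_copair_left[OF _ commuting_homs_copair_right commuting_homs_copair_right]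

lemma r_Units: "\<lbrakk>i \<in> I; j \<in> I\<rbrakk> \<Longrightarrow> r i j \<in> Units D"
  unfolding r_def by (intro alg_hom.Units[OF commuting_homs.copair_hom] cb R_Units)

lemma p_Units: "\<lbrakk>i \<in> I; j \<in> I; i \<noteq> j\<rbrakk> \<Longrightarrow> p i j \<in> Units D"
  unfolding p_def by (intro alg_hom.Units[OF commuting_homs.copair_hom] bb RB_Units)

lemma q_Units: "\<lbrakk>i \<in> I; j \<in> I; i \<noteq> j\<rbrakk> \<Longrightarrow> q i j \<in> Units D"
  unfolding q_def by (intro alg_hom.Units[OF commuting_homs.copair_hom] cc RC_Units)

lemma comm_rr: "\<lbrakk>i \<in> I; j \<in> I; l \<in> I; m \<in> I; i \<noteq> l; j \<noteq> m\<rbrakk> \<Longrightarrow> r i j \<otimes>\<^bsub>D\<^esub> r l m = r l m \<otimes>\<^bsub>D\<^esub> r i j"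
  unfolding r_def by (intro commuting_homs.comm[OF cross] R_carrier cb bb cc bc) auto

lemma comm_pr: "\<lbrakk>i \<in> I; j \<in> I; l \<in> I; m \<in> I; i \<noteq> j; m \<noteq> i; m \<noteq> j\<rbrakk> \<Longrightarrow> p i j \<otimes>\<^bsub>D\<^esub> r l m = r l m \<otimes>\<^bsub>D\<^esub> p i j"
  unfolding r_def p_def by (intro commuting_homs.comm[OF cross] R_carrier RB_carrier cb bb cc bc) auto

lemma comm_qr: "\<lbrakk>i \<in> I; j \<in> I; l \<in> I; m \<in> I; i \<noteq> j; l \<noteq> i; l \<noteq> j\<rbrakk> \<Longrightarrow> q i j \<otimes>\<^bsub>D\<^esub> r l m = r l m \<otimes>\<^bsub>D\<^esub> q i j"
  unfolding r_def q_def by (intro commuting_homs.comm[OF cross] R_carrier RC_carrier cb bb cc bc) auto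

lemma comm_pq: "\<lbrakk>i \<in> I; j \<in> I; l \<in> I; m \<in> I; i \<noteq> j; l \<noteq> m\<rbrakk> \<Longrightarrow> p i j \<otimes>\<^bsub>D\<^esub> q l m = q l m \<otimes>\<^bsub>D\<^esub> p i j"
  unfolding p_def q_def by (intro commuting_homs.comm[OF cross] RB_carrier RC_carrier cb bb cc bc) auto

lemma comm_c_p: "\<lbrakk>i \<in> I; j \<in> I; l \<in> I; i \<noteq> j; y \<in> carrier C\<rbrakk> \<Longrightarrow> p i j \<otimes>\<^bsub>D\<^esub> c l y = c l y \<otimes>\<^bsub>D\<^esub> p i j"
  unfolding p_def by (intro commuting_homs.comm[OF commuting_homs_copair_left[OF bb bc bc]] RB_carrier) auto

lemma comm_b_q: "\<lbrakk>i \<in> I; j \<in> I; l \<in> I; i \<noteq> j; x \<in> carrier B\<rbrakk> \<Longrightarrow> q i j \<otimes>\<^bsub>D\<^esub> b l x = b l x \<otimes>\<^bsub>D\<^esub> q i j"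
  unfolding q_def by (intro commuting_homs.comm[OF commuting_homs_copair_left[OF cc cb cb]] RC_carrier) auto

lemma comm_b_r: "\<lbrakk>i \<in> I; j \<in> I; l \<in> I; l \<noteq> j; x \<in> carrier B\<rbrakk> \<Longrightarrow> r i j \<otimes>\<^bsub>D\<^esub> b l x = b l x \<otimes>\<^bsub>D\<^esub> r i j"
  unfolding r_def by (intro commuting_homs.comm[OF commuting_homs_copair_left[OF cb cb bb]] R_carrier) auto

lemma comm_c_r: "\<lbrakk>i \<in> I; j \<in> I; l \<in> I; l \<noteq> i; y \<in> carrier C\<rbrakk> \<Longrightarrow> r i j \<otimes>\<^bsub>D\<^esub> c l y = c l y \<otimes>\<^bsub>D\<^esub> r i j"
  unfolding r_def by (intro commuting_homs.comm[OF commuting_homs_copair_left[OF cb cc bc]] R_carrier) auto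

lemma comultB_hom: "\<lbrakk>i \<in> I; j \<in> I; i \<noteq> j\<rbrakk> \<Longrightarrow> alg_hom K B D (comultB i j)"
  unfolding comultB_def by (intro alg_hom_comp[OF comult_B] commuting_homs.copair_hom bb)

lemma comultC_hom: "\<lbrakk>i \<in> I; j \<in> I; i \<noteq> j\<rbrakk> \<Longrightarrow> alg_hom K C D (comultC i j)"
  unfolding comultC_def by (intro alg_hom_comp[OF comult_C] commuting_homs.copair_hom cc)

lemma comultB_comultC:
  "\<lbrakk>i \<in> I; j \<in> I; i \<noteq> j; l \<in> I; m \<in> I; l \<noteq> m\<rbrakk> \<Longrightarrow> commuting_homs K B C D (comultB i j) (comultC l m)"
  unfolding comultB_def comultC_def
  by (intro commuting_homs_comp_left[OF comult_B] commuting_homs_comp_right[OF comult_C] cross bb bc cc) auto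

lemma c_comultB: "\<lbrakk>i \<in> I; j \<in> I; i \<noteq> j; l \<in> I\<rbrakk> \<Longrightarrow> commuting_homs K C B D (c l) (comultB i j)"
  unfolding comultB_def
  by (intro commuting_homs_comp_right[OF comult_B] commuting_homs_copair_right bb cb) auto

lemma comultC_b: "\<lbrakk>i \<in> I; j \<in> I; i \<noteq> j; l \<in> I\<rbrakk> \<Longrightarrow> commuting_homs K C B D (comultC i j) (b l)"
  unfolding comultC_def
  by (intro commuting_homs_comp_left[OF comult_C] commuting_homs_copair_left cc cb) auto

lemma comultB_b: "\<lbrakk>i \<in> I; j \<in> I; i \<noteq> j; l \<in> I; l \<noteq> i; l \<noteq> j\<rbrakk> \<Longrightarrow> commuting_homs K B B D (comultB i j) (b l)"
  unfolding comultB_def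
  by (intro commuting_homs_comp_left[OF comult_B] commuting_homs_copair_left bb) auto

lemma comultC_c: "\<lbrakk>i \<in> I; j \<in> I; i \<noteq> j; l \<in> I; l \<noteq> i; l \<noteq> j\<rbrakk> \<Longrightarrow> commuting_homs K C C D (comultC i j) (c l)"
  unfolding comultC_def
  by (intro commuting_homs_comp_left[OF comult_C] commuting_homs_copair_left cc) auto

lemmas b_comultB = commuting_homs_sym[OF comultB_b]
lemmas c_comultC = commuting_homs_sym[OF comultC_c]

lemma R_comultC:
  assumes "i \<in> I" "j \<in> I" "i \<noteq> j" "l \<in> I"
  shows "copair K C B D (comultC i j) (b l) R = r j l \<otimes>\<^bsub>D\<^esub> r i l"
proof -
  interpret t: three_homs K C C B D "c i" "c j" "b l"
    by (intro three_homs.intro cc cb assms)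
  interpret h: alg_hom K "tensor3 K C C B" D t.copair3
    by (rule commuting_homs.copair_hom[OF t.commuting_1_23])
  have "copair K C B D (comultC i j) (b l) R = t.copair3 (tensor_assoc K C C B (tensor_map K C B (tensor K C C) B (comult C) (\<lambda>b. b) R))"
    unfolding comultC_def by (rule t.copair3_map_left[OF comult_C R_carrier, symmetric])
  also have "\<dots> = r j l \<otimes>\<^bsub>D\<^esub> r i l"
    unfolding R_left r_def
    by (simp add: h.mult triple.leg23_closed[OF t.triple] triple.leg13_closed[OF t.triple]
        t.copair3_leg23 t.copair3_leg13 R_carrier)
  finally show ?thesis .
qed

lemma R_comultB:
  assumes "i \<in> I" "j \<in> I" "l \<in> I" "j \<noteq> l"
  shows "copair K C B D (c i) (comultB j l) R = r i j \<otimes>\<^bsub>D\<^esub> r i l"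
proof -
  interpret t: three_homs K C B B D "c i" "b j" "b l"
    by (intro three_homs.intro bb cb assms)
  interpret h: alg_hom K "tensor3 K C B B" D t.copair3
    by (rule commuting_homs.copair_hom[OF t.commuting_1_23])
  have "copair K C B D (c i) (comultB j l) R = t.copair3 (tensor_map K C B C (tensor K B B) (\<lambda>c. c) (comult B) R)"
    unfolding comultB_def by (rule t.copair3_map_right[OF comult_B R_carrier, symmetric])
  also have "\<dots> = r i j \<otimes>\<^bsub>D\<^esub> r i l"
    unfolding R_right r_def
    by (simp add: h.mult triple.leg12_closed[OF t.triple] triple.leg13_closed[OF t.triple]
        t.copair3_leg12 t.copair3_leg13 R_carrier)
  finally show ?thesis .
qed

lemma RB_comultB_left:
  assumes "i \<in> I" "j \<in> I" "i \<noteq> j" "l \<in> I" "l \<noteq> i" "l \<noteq> j"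
  shows "copair K B B D (comultB i j) (b l) RB = p i l \<otimes>\<^bsub>D\<^esub> p j l"
proof -
  interpret t: three_homs K B B B D "b i" "b j" "b l"
    by (intro three_homs.intro bb assms) (use assms in auto)
  interpret h: alg_hom K "tensor3 K B B B" D t.copair3
    by (rule commuting_homs.copair_hom[OF t.commuting_1_23])
  have "copair K B B D (comultB i j) (b l) RB = t.copair3 (tensor_assoc K B B B (tensor_map K B B (tensor K B B) B (comult B) (\<lambda>y. y) RB))"
    unfolding comultB_def by (rule t.copair3_map_left[OF comult_B RB_carrier, symmetric])
  also have "\<dots> = p i l \<otimes>\<^bsub>D\<^esub> p j l"
    unfolding RB_left p_def
    by (simp add: h.mult triple.leg13_closed[OF t.triple] triple.leg23_closed[OF t.triple]
        t.copair3_leg13 t.copair3_leg23 RB_carrier)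
  finally show ?thesis .
qed

lemma RB_comultB_right:
  assumes "i \<in> I" "j \<in> I" "i \<noteq> j" "l \<in> I" "l \<noteq> i" "l \<noteq> j"
  shows "copair K B B D (b l) (comultB i j) RB = p l j \<otimes>\<^bsub>D\<^esub> p l i"
proof -
  interpret t: three_homs K B B B D "b l" "b i" "b j"
    by (intro three_homs.intro bb assms)
  interpret h: alg_hom K "tensor3 K B B B" D t.copair3
    by (rule commuting_homs.copair_hom[OF t.commuting_1_23])
  have "copair K B B D (b l) (comultB i j) RB = t.copair3 (tensor_map K B B B (tensor K B B) (\<lambda>y. y) (comult B) RB)"
    unfolding comultB_def by (rule t.copair3_map_right[OF comult_B RB_carrier, symmetric])
  also have "\<dots> = p l j \<otimes>\<^bsub>D\<^esub> p l i"
    unfolding RB_right p_def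
    by (simp add: h.mult triple.leg13_closed[OF t.triple] triple.leg12_closed[OF t.triple]
        t.copair3_leg13 t.copair3_leg12 RB_carrier)
  finally show ?thesis .
qed

lemma comultB_swap:
  assumes "i \<in> I" "j \<in> I" "i \<noteq> j" "x \<in> carrier B"
  shows "comultB j i x = conjugate D (p i j) (comultB i j x)"
proof -
  interpret d: alg_hom K B "tensor K B B" "comult B" by (rule comult_B)
  interpret T: nc_algebra K "tensor K B B" by (rule d.cod)
  interpret ij: commuting_homs K B B D "b i" "b j" by (rule bb) (use assms in auto)
  interpret ji: commuting_homs K B B D "b j" "b i" by (rule bb) (use assms in auto)
  have "comultB j i x = copair K B B D (b i) (b j) (tensor_flip K B B (comult B x))"
    unfolding comultB_def using assms by (simp add: ji.copair_flip)
  also have "\<dots> = copair K B B D (b i) (b j) (RB \<otimes>\<^bsub>tensor K B B\<^esub> comult B x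
      \<otimes>\<^bsub>tensor K B B\<^esub> inv\<^bsub>tensor K B B\<^esub> RB)"
    using qt_B assms by (simp add: quasi_triangular_def)
  also have "\<dots> = conjugate D (p i j) (comultB i j x)"
    using assms by (simp add: ij.j.mult ij.j.inverse RB_Units RB_carrier conjugate_def p_def comultB_def)
  finally show ?thesis .
qed

lemma RC_comultC_left:
  assumes "i \<in> I" "j \<in> I" "i \<noteq> j" "l \<in> I" "l \<noteq> i" "l \<noteq> j"
  shows "copair K C C D (comultC i j) (c l) RC = q i l \<otimes>\<^bsub>D\<^esub> q j l"
proof -
  interpret t: three_homs K C C C D "c i" "c j" "c l"
    by (intro three_homs.intro cc assms) (use assms in auto)
  interpret h: alg_hom K "tensor3 K C C C" D t.copair3
    by (rule commuting_homs.copair_hom[OF t.commuting_1_23])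
  have "copair K C C D (comultC i j) (c l) RC = t.copair3 (tensor_assoc K C C C (tensor_map K C C (tensor K C C) C (comult C) (\<lambda>y. y) RC))"
    unfolding comultC_def by (rule t.copair3_map_left[OF comult_C RC_carrier, symmetric])
  also have "\<dots> = q i l \<otimes>\<^bsub>D\<^esub> q j l"
    unfolding RC_left q_def
    by (simp add: h.mult triple.leg13_closed[OF t.triple] triple.leg23_closed[OF t.triple]
        t.copair3_leg13 t.copair3_leg23 RC_carrier)
  finally show ?thesis .
qed

lemma RC_comultC_right:
  assumes "i \<in> I" "j \<in> I" "i \<noteq> j" "l \<in> I" "l \<noteq> i" "l \<noteq> j"
  shows "copair K C C D (c l) (comultC i j) RC = q l j \<otimes>\<^bsub>D\<^esub> q l i"
proof -
  interpret t: three_homs K C C C D "c l" "c i" "c j"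
    by (intro three_homs.intro cc assms)
  interpret h: alg_hom K "tensor3 K C C C" D t.copair3
    by (rule commuting_homs.copair_hom[OF t.commuting_1_23])
  have "copair K C C D (c l) (comultC i j) RC = t.copair3 (tensor_map K C C C (tensor K C C) (\<lambda>y. y) (comult C) RC)"
    unfolding comultC_def by (rule t.copair3_map_right[OF comult_C RC_carrier, symmetric])
  also have "\<dots> = q l j \<otimes>\<^bsub>D\<^esub> q l i"
    unfolding RC_right q_def
    by (simp add: h.mult triple.leg13_closed[OF t.triple] triple.leg12_closed[OF t.triple]
        t.copair3_leg13 t.copair3_leg12 RC_carrier)
  finally show ?thesis .
qed

lemma comultC_swap:
  assumes "i \<in> I" "j \<in> I" "i \<noteq> j" "x \<in> carrier C"
  shows "comultC j i x = conjugate D (q i j) (comultC i j x)"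
proof -
  interpret d: alg_hom K C "tensor K C C" "comult C" by (rule comult_C)
  interpret T: nc_algebra K "tensor K C C" by (rule d.cod)
  interpret ij: commuting_homs K C C D "c i" "c j" by (rule cc) (use assms in auto)
  interpret ji: commuting_homs K C C D "c j" "c i" by (rule cc) (use assms in auto)
  have "comultC j i x = copair K C C D (c i) (c j) (tensor_flip K C C (comult C x))"
    unfolding comultC_def using assms by (simp add: ji.copair_flip)
  also have "\<dots> = copair K C C D (c i) (c j) (RC \<otimes>\<^bsub>tensor K C C\<^esub> comult C x
      \<otimes>\<^bsub>tensor K C C\<^esub> inv\<^bsub>tensor K C C\<^esub> RC)"
    using qt_C assms by (simp add: quasi_triangular_def)
  also have "\<dots> = conjugate D (q i j) (comultC i j x)"
    using assms by (simp add: ij.j.mult ij.j.inverse RC_Units RC_carrier conjugate_def q_def comultC_def)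
  finally show ?thesis .
qed

text \<open>Conjugation is a homomorphism, hence passes through \<open>copair\<close>. In the applications only one of the
two homomorphisms is changed by the conjugation, and the other one commutes with \<open>u\<close>.\<close>

lemma conjugate_copair:
  assumes u: "u \<in> Units D" and c: "commuting_homs K A1 A2 D f g" and t: "t \<in> carrier (tensor K A1 A2)"
    and f: "\<And>x. x \<in> carrier A1 \<Longrightarrow> f' x = conjugate D u (f x)"
    and g: "\<And>y. y \<in> carrier A2 \<Longrightarrow> g' y = conjugate D u (g y)"
  shows "copair K A1 A2 D f' g' t = conjugate D u (copair K A1 A2 D f g t)"
proof -
  note h = conjugate_alg_hom[OF algebra_D u]
  show ?thesis
    unfolding commuting_homs.copair_comp[OF c h t]
    by (rule commuting_homs.copair_cong[OF commuting_homs.commuting_homs_comp[OF c h] f g t])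
qed

lemma pure_closed_D:
  "\<lbrakk>i \<in> I; x \<in> carrier B\<rbrakk> \<Longrightarrow> b i x \<in> carrier D"
  "\<lbrakk>i \<in> I; y \<in> carrier C\<rbrakk> \<Longrightarrow> c i y \<in> carrier D"
  unfolding b_def c_def
  using alg_hom.closed[OF hom] alg_hom.closed[OF inB_hom] alg_hom.closed[OF inC_hom] by auto

text \<open>The products \<open>r i j \<cdot> r i l\<close> and \<open>r i l \<cdot> r i j\<close> are \<open>R\<close> with \<open>\<Delta>\<^sup>B\<close> and with \<open>(\<Delta>\<^sup>B)\<^sup>o\<^sup>p\<close> applied to
its \<open>B\<close>-component, and \<open>p j l\<close> conjugates the one comultiplication into the other while commuting
with the \<open>C\<close>-component. The copy \<open>i\<close> may be \<open>j\<close> or \<open>l\<close>, because \<open>B\<close> and \<open>C\<close> commute within one copy.\<close>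

lemma yang_baxter_B:
  assumes "i \<in> I" "j \<in> I" "l \<in> I" "j \<noteq> l"
  shows "p j l \<otimes>\<^bsub>D\<^esub> (r i j \<otimes>\<^bsub>D\<^esub> r i l) = r i l \<otimes>\<^bsub>D\<^esub> r i j \<otimes>\<^bsub>D\<^esub> p j l"
proof -
  have p: "p j l \<in> Units D" using assms by (intro p_Units)
  have "r i l \<otimes>\<^bsub>D\<^esub> r i j = copair K C B D (c i) (comultB l j) R"
    using assms by (intro R_comultB[symmetric]) auto
  also have "\<dots> = conjugate D (p j l) (copair K C B D (c i) (comultB j l) R)"
    using assms
    by (intro conjugate_copair p c_comultB R_carrier comultB_swap D.conjugate_commuting[symmetric] comm_c_p pure_closed_D) auto
  also have "\<dots> = conjugate D (p j l) (r i j \<otimes>\<^bsub>D\<^esub> r i l)"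
    using assms by (subst R_comultB) auto
  finally have "r i l \<otimes>\<^bsub>D\<^esub> r i j \<otimes>\<^bsub>D\<^esub> p j l = conjugate D (p j l) (r i j \<otimes>\<^bsub>D\<^esub> r i l) \<otimes>\<^bsub>D\<^esub> p j l"
    by simp
  then show ?thesis
    using p r_Units[THEN D.Units_closed] assms by (simp add: conjugate_def D.m_assoc D.Units_closed)
qed

lemma yang_baxter_C:
  assumes "i \<in> I" "j \<in> I" "l \<in> I" "i \<noteq> j"
  shows "q i j \<otimes>\<^bsub>D\<^esub> (r j l \<otimes>\<^bsub>D\<^esub> r i l) = r i l \<otimes>\<^bsub>D\<^esub> r j l \<otimes>\<^bsub>D\<^esub> q i j"
proof -
  have q: "q i j \<in> Units D" using assms by (intro q_Units)
  have "r i l \<otimes>\<^bsub>D\<^esub> r j l = copair K C B D (comultC j i) (b l) R"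
    using assms by (intro R_comultC[symmetric]) auto
  also have "\<dots> = conjugate D (q i j) (copair K C B D (comultC i j) (b l) R)"
    using assms
    by (intro conjugate_copair q comultC_b R_carrier comultC_swap D.conjugate_commuting[symmetric] comm_b_q pure_closed_D) auto
  also have "\<dots> = conjugate D (q i j) (r j l \<otimes>\<^bsub>D\<^esub> r i l)"
    using assms by (subst R_comultC) auto
  finally have "r i l \<otimes>\<^bsub>D\<^esub> r j l \<otimes>\<^bsub>D\<^esub> q i j = conjugate D (q i j) (r j l \<otimes>\<^bsub>D\<^esub> r i l) \<otimes>\<^bsub>D\<^esub> q i j"
    by simp
  then show ?thesis
    using q r_Units[THEN D.Units_closed] assms by (simp add: conjugate_def D.m_assoc D.Units_closed)
qed

end

section \<open>The twisted comultiplication\<close>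

context twist
begin

lemma positions_BCBC:
  "positions K B C R RB RC (tensor_BCBC K B C) (\<lambda>i. if i = 1 then left else right) {1, 2}"
proof (intro positions.intro positions_axioms.intro twist_axioms algebra_BCBC)
  show "alg_hom K BC (tensor_BCBC K B C) (if i = 1 then left else right)" for i :: nat
    using tensor_algebra.inl_hom[OF tensor_algebra_BCBC] tensor_algebra.inr_hom[OF tensor_algebra_BCBC]
    by simp
  show "commuting_homs K BC BC (tensor_BCBC K B C) (if i = 1 then left else right) (if j = 1 then left else right)"
    if "i \<in> {1, 2}" "j \<in> {1, 2}" "i \<noteq> j" for i j :: nat
    using that commuting_left_right commuting_homs_sym[OF commuting_left_right] by auto
qed

interpretation D2: positions K B C R RB RC "tensor_BCBC K B C" "\<lambda>i. if i = 1 then left else right" "{1, 2}"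
  by (rule positions_BCBC)

interpretation T: nc_algebra K "tensor_BCBC K B C" by (rule algebra_BCBC)

lemma cb23_eq: "cb23 K B C R = D2.r 1 2"
  and cb41_eq: "cb41 K B C R = D2.r 2 1"
  and bb13_eq: "bb13 K B C RB = D2.p 1 2"
  and cc24_eq: "cc24 K B C RC = D2.q 1 2"
  and bb13_comult: "x \<in> carrier B \<Longrightarrow> bb13 K B C (comult B x) = D2.comultB 1 2 x"
  and cc24_comult: "y \<in> carrier C \<Longrightarrow> cc24 K B C (comult C y) = D2.comultC 1 2 y"
  unfolding D2.r_def D2.p_def D2.q_def D2.comultB_def D2.comultC_def D2.b_def D2.c_def
  using alg_hom.closed[OF comult_B, of x] alg_hom.closed[OF comult_C, of y]
  by (simp_all add: cb23_eq_copair cb41_eq_copair bb13_eq_copair cc24_eq_copair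
      R_carrier RB_carrier RC_carrier)

definition "twisted_R = cb41 K B C R \<otimes>\<^bsub>tensor_BCBC K B C\<^esub> bb13 K B C RB
       \<otimes>\<^bsub>tensor_BCBC K B C\<^esub> cc24 K B C RC
       \<otimes>\<^bsub>tensor_BCBC K B C\<^esub> inv\<^bsub>tensor_BCBC K B C\<^esub> (cb23 K B C R)"

definition "twisted_comult = tensor_lift K B C (tensor_BCBC K B C) (\<lambda>b c.
          cb23 K B C R \<otimes>\<^bsub>tensor_BCBC K B C\<^esub> bb13 K B C (comult B b)
            \<otimes>\<^bsub>tensor_BCBC K B C\<^esub> cc24 K B C (comult C c)
            \<otimes>\<^bsub>tensor_BCBC K B C\<^esub> inv\<^bsub>tensor_BCBC K B C\<^esub> (cb23 K B C R))"

lemma leg_Units: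
  "cb23 K B C R \<in> Units (tensor_BCBC K B C)" "cb41 K B C R \<in> Units (tensor_BCBC K B C)"
  "bb13 K B C RB \<in> Units (tensor_BCBC K B C)" "cc24 K B C RC \<in> Units (tensor_BCBC K B C)"
  unfolding cb23_eq cb41_eq bb13_eq cc24_eq
  by (intro D2.r_Units D2.p_Units D2.q_Units; simp)+

lemma twisted_R_Units: "twisted_R \<in> Units (tensor_BCBC K B C)"
  unfolding twisted_R_def by (intro T.Units_m_closed T.Units_inv_Units leg_Units)

lemma twisted_R_carrier: "twisted_R \<in> carrier (tensor_BCBC K B C)"
  using twisted_R_Units by (rule T.Units_closed)

text \<open>The twisted comultiplication is the copair of the two conjugated comultiplications, since conjugation
is multiplicative. So it is a homomorphism, determined by its values on \<open>B\<close> and on \<open>C\<close>.\<close>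

lemma
  shows twisted_comult_hom: "alg_hom K BC (tensor_BCBC K B C) twisted_comult"
    and twisted_comult_inB: "x \<in> carrier B \<Longrightarrow> twisted_comult (inB x) =
      conjugate (tensor_BCBC K B C) (cb23 K B C R) (bb13 K B C (comult B x))"
    and twisted_comult_inC: "y \<in> carrier C \<Longrightarrow> twisted_comult (inC y) =
      conjugate (tensor_BCBC K B C) (cb23 K B C R) (cc24 K B C (comult C y))"
proof -
  let ?T = "tensor_BCBC K B C" and ?f = "D2.r 1 2"
  let ?g = "\<lambda>x. conjugate ?T ?f (D2.comultB 1 2 x)" and ?h = "\<lambda>y. conjugate ?T ?f (D2.comultC 1 2 y)"
  have f: "?f \<in> Units ?T" by (rule D2.r_Units) simp_all
  have c: "commuting_homs K B C ?T ?g ?h"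
    by (rule commuting_homs.commuting_homs_comp[OF D2.comultB_comultC conjugate_alg_hom[OF algebra_BCBC f]]) simp_all
  have "twisted_comult z = copair K B C ?T ?g ?h z" if z: "z \<in> carrier BC" for z
    unfolding twisted_comult_def using z
  proof (rule commuting_homs.lift_eq_copair[OF c])
    fix x y assume x: "x \<in> carrier B" and y: "y \<in> carrier C"
    have "D2.comultB 1 2 x \<in> carrier ?T" "D2.comultC 1 2 y \<in> carrier ?T"
      using alg_hom.closed[OF D2.comultB_hom x] alg_hom.closed[OF D2.comultC_hom y] by simp_all
    then show "cb23 K B C R \<otimes>\<^bsub>?T\<^esub> bb13 K B C (comult B x) \<otimes>\<^bsub>?T\<^esub> cc24 K B C (comult C y) \<otimes>\<^bsub>?T\<^esub> inv\<^bsub>?T\<^esub> (cb23 K B C R)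
        = ?g x \<otimes>\<^bsub>?T\<^esub> ?h y"
      using f by (simp add: cb23_eq bb13_comult x cc24_comult y T.Units_closed T.m_assoc
          T.conjugate_mult[symmetric] conjugate_def[of _ _ "_ \<otimes>\<^bsub>?T\<^esub> _"])
  qed
  note eq = this
  show "alg_hom K BC ?T twisted_comult"
    by (rule alg_hom_cong[OF commuting_homs.copair_hom[OF c] eq])
  show "twisted_comult (inB x) = conjugate ?T (cb23 K B C R) (bb13 K B C (comult B x))"
    if x: "x \<in> carrier B" for x
    by (simp only: eq[OF alg_hom.closed[OF inB_hom x]] commuting_homs.copair_inl[OF c x] cb23_eq bb13_comult[OF x])
  show "twisted_comult (inC y) = conjugate ?T (cb23 K B C R) (cc24 K B C (comult C y))"
    if y: "y \<in> carrier C" for y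
    by (simp only: eq[OF alg_hom.closed[OF inC_hom y]] commuting_homs.copair_inr[OF c y] cb23_eq cc24_comult[OF y])
qed

end

context positions
begin

interpretation D: nc_algebra K D by (rule algebra_D)

text \<open>The structure element in copies \<open>i\<close>, \<open>j\<close>, and the comultiplication with values in these copies.\<close>

definition "t i j = copair K BC BC D (k i) (k j) twisted_R"
definition "comultT i j z = copair K BC BC D (k i) (k j) (twisted_comult z)"

lemma
  assumes "i \<in> I" "j \<in> I" "i \<noteq> j"
  shows k_cb23: "copair K BC BC D (k i) (k j) (cb23 K B C R) = r i j"
    and k_cb41: "copair K BC BC D (k i) (k j) (cb41 K B C R) = r j i"
    and k_bb13: "copair K BC BC D (k i) (k j) (bb13 K B C RB) = p i j"
    and k_cc24: "copair K BC BC D (k i) (k j) (cc24 K B C RC) = q i j"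
    and k_bb13_comult: "x \<in> carrier B \<Longrightarrow> copair K BC BC D (k i) (k j) (bb13 K B C (comult B x)) = comultB i j x"
    and k_cc24_comult: "y \<in> carrier C \<Longrightarrow> copair K BC BC D (k i) (k j) (cc24 K B C (comult C y)) = comultC i j y"
  unfolding r_def p_def q_def comultB_def comultC_def b_def c_def
  using commuting[OF assms] alg_hom.closed[OF comult_B] alg_hom.closed[OF comult_C]
  by (simp_all add: copair_cb23 copair_cb41 copair_bb13 copair_cc24 R_carrier RB_carrier RC_carrier)

lemma hom_twisted_R:
  assumes h: "alg_hom K (tensor_BCBC K B C) D h"
  shows "h twisted_R = h (cb41 K B C R) \<otimes>\<^bsub>D\<^esub> h (bb13 K B C RB) \<otimes>\<^bsub>D\<^esub> h (cc24 K B C RC)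
    \<otimes>\<^bsub>D\<^esub> inv\<^bsub>D\<^esub> (h (cb23 K B C R))"
proof -
  interpret h: alg_hom K "tensor_BCBC K B C" D h by fact
  interpret T: nc_algebra K "tensor_BCBC K B C" by (rule algebra_BCBC)
  note [simp] = leg_Units leg_Units[THEN T.Units_closed]
  show ?thesis unfolding twisted_R_def by (simp add: h.mult h.inverse)
qed

lemma t_eq:
  assumes "i \<in> I" "j \<in> I" "i \<noteq> j"
  shows "t i j = r j i \<otimes>\<^bsub>D\<^esub> p i j \<otimes>\<^bsub>D\<^esub> q i j \<otimes>\<^bsub>D\<^esub> inv\<^bsub>D\<^esub> (r i j)"
  using assms unfolding t_def
  by (simp add: hom_twisted_R[OF commuting_homs.copair_hom[OF commuting]] k_cb23 k_cb41 k_bb13 k_cc24)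

lemma comultT_hom:
  assumes "i \<in> I" "j \<in> I" "i \<noteq> j"
  shows "alg_hom K BC D (comultT i j)"
  unfolding comultT_def
  by (intro alg_hom_comp[OF twisted_comult_hom] commuting_homs.copair_hom commuting assms)

lemma
  assumes ij: "i \<in> I" "j \<in> I" "i \<noteq> j"
  shows comultT_inB: "x \<in> carrier B \<Longrightarrow> comultT i j (inB x) = conjugate D (r i j) (comultB i j x)"
    and comultT_inC: "y \<in> carrier C \<Longrightarrow> comultT i j (inC y) = conjugate D (r i j) (comultC i j y)"
proof -
  interpret h: alg_hom K "tensor_BCBC K B C" D "copair K BC BC D (k i) (k j)"
    by (intro commuting_homs.copair_hom commuting ij)
  interpret B: alg_hom K B "tensor K B B" "comult B" by (rule comult_B)
  interpret C: alg_hom K C "tensor K C C" "comult C" by (rule comult_C)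
  note c = commuting_left_right
  note [simp] = bb13_eq_copair cc24_eq_copair alg_hom.closed[OF commuting_homs.copair_hom[OF commuting_BB[OF c]]]
    alg_hom.closed[OF commuting_homs.copair_hom[OF commuting_CC[OF c]]]
  show "comultT i j (inB x) = conjugate D (r i j) (comultB i j x)" if x: "x \<in> carrier B" for x
  proof -
    have "bb13 K B C (comult B x) \<in> carrier (tensor_BCBC K B C)" using x by simp
    then show ?thesis
      unfolding comultT_def twisted_comult_inB[OF x] h.conjugate[OF leg_Units(1) \<open>bb13 K B C (comult B x) \<in> _\<close>]
      by (simp only: k_cb23[OF ij] k_bb13_comult[OF ij x])
  qed
  show "comultT i j (inC y) = conjugate D (r i j) (comultC i j y)" if y: "y \<in> carrier C" for y
  proof -
    have "cc24 K B C (comult C y) \<in> carrier (tensor_BCBC K B C)" using y by simp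
    then show ?thesis
      unfolding comultT_def twisted_comult_inC[OF y] h.conjugate[OF leg_Units(1) \<open>cc24 K B C (comult C y) \<in> _\<close>]
      by (simp only: k_cb23[OF ij] k_cc24_comult[OF ij y])
  qed
qed

context
  fixes i j l
  assumes ijl: "i \<in> I" "j \<in> I" "l \<in> I" "i \<noteq> j" "l \<noteq> i" "l \<noteq> j"
begin

lemma comultT_k: "commuting_homs K BC BC D (comultT i j) (k l)"
  unfolding comultT_def
  by (intro commuting_homs_comp_left[OF twisted_comult_hom] commuting_homs_copair_left commuting)
     (use ijl in auto)

text \<open>In \<open>\<Delta> \<otimes> id\<close> and \<open>id \<otimes> \<Delta>\<close> only the first, respectively second, homomorphism is conjugated by
\<open>r i j\<close>. But the copy \<open>l\<close> commutes with \<open>r i j\<close>, so both homomorphisms may be taken to be conjugated, and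
the conjugation can be pulled out of the copair.\<close>

lemma k_conjugate:
  "x \<in> carrier B \<Longrightarrow> k l (inB x) = conjugate D (r i j) (b l x)"
  "y \<in> carrier C \<Longrightarrow> k l (inC y) = conjugate D (r i j) (c l y)"
  unfolding b_def[symmetric] c_def[symmetric]
  using ijl by (auto intro!: D.conjugate_commuting[symmetric] r_Units comm_b_r comm_c_r pure_closed_D)

lemmas carrs = r_Units p_Units q_Units
  r_Units[THEN D.Units_closed] p_Units[THEN D.Units_closed] q_Units[THEN D.Units_closed]

lemma conjugate_twisted:
  assumes "x1 \<in> carrier D" "x2 \<in> carrier D" "x3 \<in> carrier D" "x4 \<in> Units D"
  shows "conjugate D (r i j) x1 \<otimes>\<^bsub>D\<^esub> conjugate D (r i j) x2 \<otimes>\<^bsub>D\<^esub> conjugate D (r i j) x3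
      \<otimes>\<^bsub>D\<^esub> inv\<^bsub>D\<^esub> (conjugate D (r i j) x4) =
    conjugate D (r i j) (x1 \<otimes>\<^bsub>D\<^esub> x2 \<otimes>\<^bsub>D\<^esub> x3 \<otimes>\<^bsub>D\<^esub> inv\<^bsub>D\<^esub> x4)"
proof -
  have u: "r i j \<in> Units D" using ijl by (intro r_Units)
  interpret h: alg_hom K D D "conjugate D (r i j)" by (rule conjugate_alg_hom[OF algebra_D u])
  show ?thesis using assms by (simp add: h.mult h.inverse D.Units_closed)
qed

text \<open>The image of each of the four factors is computed from the hypothesis on it. The result is the conjugate by
\<open>r i j\<close> of a product to which \<open>conjugate_regroup\<close> applies, with \<open>p\<close> for \<open>a\<close>, \<open>b\<close> and \<open>q\<close> for
\<open>c\<close>, \<open>d\<close>.\<close>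

lemma comultT_left: "copair K BC BC D (comultT i j) (k l) twisted_R = t i l \<otimes>\<^bsub>D\<^esub> t j l"
proof -
  let ?c = "conjugate D (r i j)" and ?h = "copair K BC BC D (comultT i j) (k l)"
  have u: "r i j \<in> Units D" using ijl by (intro r_Units)
  note sim = comultT_inB comultT_inC k_conjugate
  have 1: "?h (cb41 K B C R) = ?c (r l i \<otimes>\<^bsub>D\<^esub> r l j)"
    unfolding copair_cb41[OF comultT_k R_carrier] using ijl
    by (subst R_comultB[symmetric]; (intro conjugate_copair u c_comultB R_carrier sim)?; simp)
  have 2: "?h (bb13 K B C RB) = ?c (p i l \<otimes>\<^bsub>D\<^esub> p j l)"
    unfolding copair_bb13[OF comultT_k RB_carrier] using ijl
    by (subst RB_comultB_left[symmetric]; (intro conjugate_copair u comultB_b RB_carrier sim)?; simp)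
  have 3: "?h (cc24 K B C RC) = ?c (q i l \<otimes>\<^bsub>D\<^esub> q j l)"
    unfolding copair_cc24[OF comultT_k RC_carrier] using ijl
    by (subst RC_comultC_left[symmetric]; (intro conjugate_copair u comultC_c RC_carrier sim)?; simp)
  have 4: "?h (cb23 K B C R) = ?c (r j l \<otimes>\<^bsub>D\<^esub> r i l)"
    unfolding copair_cb23[OF comultT_k R_carrier] using ijl
    by (subst R_comultC[symmetric]; (intro conjugate_copair u comultC_b R_carrier sim)?; simp)
  have "?h twisted_R = ?c ((r l i \<otimes>\<^bsub>D\<^esub> r l j) \<otimes>\<^bsub>D\<^esub> (p i l \<otimes>\<^bsub>D\<^esub> p j l) \<otimes>\<^bsub>D\<^esub> (q i l \<otimes>\<^bsub>D\<^esub> q j l)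
      \<otimes>\<^bsub>D\<^esub> inv\<^bsub>D\<^esub> (r j l \<otimes>\<^bsub>D\<^esub> r i l))"
    unfolding hom_twisted_R[OF commuting_homs.copair_hom[OF comultT_k]] 1 2 3 4
    using ijl by (intro conjugate_twisted D.m_closed D.Units_m_closed carrs) auto
  also have "\<dots> = (r l i \<otimes>\<^bsub>D\<^esub> p i l \<otimes>\<^bsub>D\<^esub> q i l \<otimes>\<^bsub>D\<^esub> inv\<^bsub>D\<^esub> (r i l)) \<otimes>\<^bsub>D\<^esub>
      (r l j \<otimes>\<^bsub>D\<^esub> p j l \<otimes>\<^bsub>D\<^esub> q j l \<otimes>\<^bsub>D\<^esub> inv\<^bsub>D\<^esub> (r j l))"
    using ijl
    by (intro D.conjugate_regroup carrs comm_rr comm_pr comm_qr comm_pq comm_pr[symmetric]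
        yang_baxter_B yang_baxter_C) auto
  finally show ?thesis using ijl by (simp add: t_eq)
qed

text \<open>Now the relation of \<open>p\<close> is needed at the left of the twist and that of \<open>q\<close> at the right, so the two have
to be exchanged before and after \<open>conjugate_regroup\<close>.\<close>

lemma comultT_right: "copair K BC BC D (k l) (comultT i j) twisted_R = t l j \<otimes>\<^bsub>D\<^esub> t l i"
proof -
  let ?c = "conjugate D (r i j)" and ?h = "copair K BC BC D (k l) (comultT i j)"
  have u: "r i j \<in> Units D" using ijl by (intro r_Units)
  note sim = comultT_inB comultT_inC k_conjugate
  note k_comultT = commuting_homs_sym[OF comultT_k]
  have 1: "?h (cb41 K B C R) = ?c (r j l \<otimes>\<^bsub>D\<^esub> r i l)"
    unfolding copair_cb41[OF k_comultT R_carrier] using ijl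
    by (subst R_comultC[symmetric]; (intro conjugate_copair u comultC_b R_carrier sim)?; simp)
  have 2: "?h (bb13 K B C RB) = ?c (p l j \<otimes>\<^bsub>D\<^esub> p l i)"
    unfolding copair_bb13[OF k_comultT RB_carrier] using ijl
    by (subst RB_comultB_right[symmetric]; (intro conjugate_copair u b_comultB RB_carrier sim)?; simp)
  have 3: "?h (cc24 K B C RC) = ?c (q l j \<otimes>\<^bsub>D\<^esub> q l i)"
    unfolding copair_cc24[OF k_comultT RC_carrier] using ijl
    by (subst RC_comultC_right[symmetric]; (intro conjugate_copair u c_comultC RC_carrier sim)?; simp)
  have 4: "?h (cb23 K B C R) = ?c (r l i \<otimes>\<^bsub>D\<^esub> r l j)"
    unfolding copair_cb23[OF k_comultT R_carrier] using ijl
    by (subst R_comultB[symmetric]; (intro conjugate_copair u c_comultB R_carrier sim)?; simp)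
  have pq: "p l j \<otimes>\<^bsub>D\<^esub> q l j = q l j \<otimes>\<^bsub>D\<^esub> p l j" "p l i \<otimes>\<^bsub>D\<^esub> q l i = q l i \<otimes>\<^bsub>D\<^esub> p l i"
    using ijl by (auto intro!: comm_pq)
  have pq': "(p l j \<otimes>\<^bsub>D\<^esub> p l i) \<otimes>\<^bsub>D\<^esub> (q l j \<otimes>\<^bsub>D\<^esub> q l i) = (q l j \<otimes>\<^bsub>D\<^esub> q l i) \<otimes>\<^bsub>D\<^esub> (p l j \<otimes>\<^bsub>D\<^esub> p l i)"
    using ijl by (intro D.commute_mult_left D.commute_mult_right comm_pq D.m_closed carrs) auto
  have "?h twisted_R = ?c ((r j l \<otimes>\<^bsub>D\<^esub> r i l) \<otimes>\<^bsub>D\<^esub> (p l j \<otimes>\<^bsub>D\<^esub> p l i) \<otimes>\<^bsub>D\<^esub> (q l j \<otimes>\<^bsub>D\<^esub> q l i)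
      \<otimes>\<^bsub>D\<^esub> inv\<^bsub>D\<^esub> (r l i \<otimes>\<^bsub>D\<^esub> r l j))"
    unfolding hom_twisted_R[OF commuting_homs.copair_hom[OF k_comultT]] 1 2 3 4
    using ijl by (intro conjugate_twisted D.m_closed D.Units_m_closed carrs) auto
  also have "(r j l \<otimes>\<^bsub>D\<^esub> r i l) \<otimes>\<^bsub>D\<^esub> (p l j \<otimes>\<^bsub>D\<^esub> p l i) \<otimes>\<^bsub>D\<^esub> (q l j \<otimes>\<^bsub>D\<^esub> q l i) =
      (r j l \<otimes>\<^bsub>D\<^esub> r i l) \<otimes>\<^bsub>D\<^esub> (q l j \<otimes>\<^bsub>D\<^esub> q l i) \<otimes>\<^bsub>D\<^esub> (p l j \<otimes>\<^bsub>D\<^esub> p l i)"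
    using ijl pq' by (simp add: D.m_assoc carrs)
  also have "?c ((r j l \<otimes>\<^bsub>D\<^esub> r i l) \<otimes>\<^bsub>D\<^esub> (q l j \<otimes>\<^bsub>D\<^esub> q l i) \<otimes>\<^bsub>D\<^esub> (p l j \<otimes>\<^bsub>D\<^esub> p l i)
      \<otimes>\<^bsub>D\<^esub> inv\<^bsub>D\<^esub> (r l i \<otimes>\<^bsub>D\<^esub> r l j)) =
      (r j l \<otimes>\<^bsub>D\<^esub> q l j \<otimes>\<^bsub>D\<^esub> p l j \<otimes>\<^bsub>D\<^esub> inv\<^bsub>D\<^esub> (r l j)) \<otimes>\<^bsub>D\<^esub>
      (r i l \<otimes>\<^bsub>D\<^esub> q l i \<otimes>\<^bsub>D\<^esub> p l i \<otimes>\<^bsub>D\<^esub> inv\<^bsub>D\<^esub> (r l i))"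
    using ijl
    by (intro D.conjugate_regroup carrs comm_rr comm_pr comm_qr comm_pq[symmetric] comm_qr[symmetric]
        yang_baxter_B yang_baxter_C) auto
  also have "\<dots> = t l j \<otimes>\<^bsub>D\<^esub> t l i"
    using ijl pq by (simp add: t_eq D.m_assoc carrs)
  finally show ?thesis .
qed

end

text \<open>It is enough to compare both sides on \<open>B\<close> and on \<open>C\<close>. The element \<open>t i j \<cdot> r i j = r j i \<cdot> p i j \<cdot> q i j\<close>
acts there by conjugation: on \<open>B\<close> the factor \<open>q i j\<close> has no effect and \<open>p i j\<close> turns \<open>\<Delta>\<^sup>B\<close> into its
opposite, and on \<open>C\<close> their roles are exchanged.\<close>

lemma comultT_swap:
  assumes ij: "i \<in> I" "j \<in> I" "i \<noteq> j" and z: "z \<in> carrier BC"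
  shows "comultT j i z = conjugate D (t i j) (comultT i j z)"
proof -
  have rpq: "r i j \<in> Units D" "r j i \<in> Units D" "p i j \<in> Units D" "q i j \<in> Units D"
    using ij by (auto intro: r_Units p_Units q_Units)
  then have u: "t i j \<in> Units D" using ij by (simp add: t_eq)
  have tr: "t i j \<otimes>\<^bsub>D\<^esub> r i j = r j i \<otimes>\<^bsub>D\<^esub> (p i j \<otimes>\<^bsub>D\<^esub> q i j)"
    using ij rpq by (simp add: t_eq D.m_assoc D.Units_closed)
  have dB: "comultB i j x \<in> carrier D" "comultB j i x \<in> carrier D" if "x \<in> carrier B" for x
    using ij that by (auto intro!: alg_hom.closed[OF comultB_hom])
  have dC: "comultC i j y \<in> carrier D" "comultC j i y \<in> carrier D" if "y \<in> carrier C" for y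
    using ij that by (auto intro!: alg_hom.closed[OF comultC_hom])
  have conj: "conjugate D (t i j) (conjugate D (r i j) w) =
      conjugate D (r j i) (conjugate D (p i j) (conjugate D (q i j) w))" if "w \<in> carrier D" for w
  proof -
    have "conjugate D (q i j) w \<in> carrier D"
      using that rpq by (simp add: conjugate_def D.Units_closed)
    then show ?thesis using that u rpq by (simp add: D.conjugate_conjugate tr D.m_assoc D.Units_closed)
  qed
  show ?thesis
  proof (rule tensor_algebra.hom_eqI[OF tensor_algebra_BC comultT_hom
        alg_hom_comp[OF comultT_hom conjugate_alg_hom[OF algebra_D u]] _ _ z])
    fix x assume x: "x \<in> carrier B"
    have "q i j \<otimes>\<^bsub>D\<^esub> comultB i j x = comultB i j x \<otimes>\<^bsub>D\<^esub> q i j"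
      unfolding q_def comultB_def using ij x
      by (intro commuting_homs.comm[OF cross] RC_carrier alg_hom.closed[OF comult_B] cb bb cc) auto
    then have "conjugate D (q i j) (comultB i j x) = comultB i j x"
      using rpq dB x by (intro D.conjugate_commuting)
    moreover have "comultB j i x = conjugate D (p i j) (comultB i j x)"
      using ij x by (intro comultB_swap)
    ultimately show "comultT j i (inB x) = conjugate D (t i j) (comultT i j (inB x))"
      using ij x dB by (simp add: comultT_inB conj)
  next
    fix y assume y: "y \<in> carrier C"
    have "p i j \<otimes>\<^bsub>D\<^esub> comultC j i y = comultC j i y \<otimes>\<^bsub>D\<^esub> p i j"
      unfolding p_def comultC_def using ij y
      by (intro commuting_homs.comm[OF cross] RB_carrier alg_hom.closed[OF comult_C] bc bb cc) auto
    then have "conjugate D (p i j) (comultC j i y) = comultC j i y"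
      using rpq dC y by (intro D.conjugate_commuting)
    moreover have "comultC j i y = conjugate D (q i j) (comultC i j y)"
      using ij y by (intro comultC_swap)
    ultimately show "comultT j i (inC y) = conjugate D (t i j) (comultT i j (inC y))"
      using ij y dC by (simp add: comultT_inC conj)
  qed (use ij in auto)
qed

end

context twist
begin

lemma twisted_cocommutative:
  assumes z: "z \<in> carrier BC"
  shows "tensor_flip K BC BC (twisted_comult z) = twisted_R \<otimes>\<^bsub>tensor_BCBC K B C\<^esub> twisted_comult z
    \<otimes>\<^bsub>tensor_BCBC K B C\<^esub> inv\<^bsub>tensor_BCBC K B C\<^esub> twisted_R"
proof -
  interpret D2: positions K B C R RB RC "tensor_BCBC K B C" "\<lambda>i. if i = 1 then left else right" "{1, 2}"
    by (rule positions_BCBC)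
  note id = tensor_algebra.copair_inl_inr[OF tensor_algebra_BCBC]
  have d: "twisted_comult z \<in> carrier (tensor_BCBC K B C)"
    using z by (rule alg_hom.closed[OF twisted_comult_hom])
  have "tensor_flip K BC BC (twisted_comult z) = D2.comultT 2 1 z"
    unfolding D2.comultT_def by (simp add: tensor_flip_eq_copair[OF tensor_algebra_BCBC d])
  also have "\<dots> = conjugate (tensor_BCBC K B C) (D2.t 1 2) (D2.comultT 1 2 z)"
    using z by (intro D2.comultT_swap) auto
  also have "D2.t 1 2 = twisted_R" unfolding D2.t_def by (simp add: id twisted_R_carrier)
  also have "D2.comultT 1 2 z = twisted_comult z" unfolding D2.comultT_def by (simp add: id d)
  finally show ?thesis by (simp add: conjugate_def)
qed

lemma
  shows twisted_left: "tensor_assoc K BC BC BC (tensor_map K BC BC (tensor_BCBC K B C) BC twisted_comult (\<lambda>y. y) twisted_R) =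
      leg13 K BC BC BC twisted_R \<otimes>\<^bsub>tensor3 K BC BC BC\<^esub> leg23 K BC BC BC twisted_R"
    and twisted_right: "tensor_map K BC BC BC (tensor_BCBC K B C) (\<lambda>y. y) twisted_comult twisted_R =
      leg13 K BC BC BC twisted_R \<otimes>\<^bsub>tensor3 K BC BC BC\<^esub> leg12 K BC BC BC twisted_R"
proof -
  interpret t: triple K BC BC BC by (intro triple.intro algebra_BC)
  interpret can: three_homs K BC BC BC "tensor3 K BC BC BC" t.in1 t.in2 t.in3
    by (rule t.three_homs_in)
  let ?E = "tensor3 K BC BC BC"
  let ?k = "\<lambda>i. if i = 1 then t.in1 else if i = 2 then t.in2 else t.in3"
  interpret E: positions K B C R RB RC ?E ?k "{1, 2, 3}"
  proof (intro positions.intro positions_axioms.intro twist_axioms can.c12.f.cod)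
    show "alg_hom K BC ?E (?k i)" for i
      using can.c12.f.alg_hom_axioms can.c12.g.alg_hom_axioms can.c13.g.alg_hom_axioms by simp
    note cs = can.c12.commuting_homs_axioms can.c13.commuting_homs_axioms can.c23.commuting_homs_axioms
    show "commuting_homs K BC BC ?E (?k i) (?k j)"
      if "i \<in> {1, 2, 3}" "j \<in> {1, 2, 3}" "i \<noteq> j" for i j :: nat
      using that cs cs[THEN commuting_homs_sym] by auto
  qed
  note tR = twisted_R_carrier
  have legs: "leg12 K BC BC BC twisted_R = E.t 1 2" "leg13 K BC BC BC twisted_R = E.t 1 3"
    "leg23 K BC BC BC twisted_R = E.t 2 3"
    unfolding E.t_def by (simp_all add: t.leg12_eq_copair t.leg13_eq_copair t.leg23_eq_copair tR)
  \<comment> \<open>These memberships are needed to apply \<open>copair3_in\<close>, which turns the rules for \<open>D\<close> into statements about the tensor product itself.\<close>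
  note l = t.assoc_map_closed[OF twisted_comult_hom tR]
  note r = tensor_map_closed[OF alg_hom_id[OF algebra_BC] twisted_comult_hom tR]
  show "tensor_assoc K BC BC BC (tensor_map K BC BC (tensor_BCBC K B C) BC twisted_comult (\<lambda>y. y) twisted_R) =
      leg13 K BC BC BC twisted_R \<otimes>\<^bsub>?E\<^esub> leg23 K BC BC BC twisted_R"
    using E.comultT_left[of 1 2 3] can.copair3_map_left[OF twisted_comult_hom tR] t.copair3_in[OF l]
    unfolding legs E.comultT_def by simp
  show "tensor_map K BC BC BC (tensor_BCBC K B C) (\<lambda>y. y) twisted_comult twisted_R =
      leg13 K BC BC BC twisted_R \<otimes>\<^bsub>?E\<^esub> leg12 K BC BC BC twisted_R"
    using E.comultT_right[of 2 3 1] can.copair3_map_right[OF twisted_comult_hom tR] t.copair3_in[OF r]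
    unfolding legs E.comultT_def by simp
qed

end

section \<open>Quasi-triangularity\<close>

text \<open>Tensor products depend only on the module and ring structure, so extending an algebra by the operations of a
Hopf algebra does not change them.\<close>

lemma extend_simps [simp]:
  "carrier (module.extend A X') = carrier A" "monoid.mult (module.extend A X') = monoid.mult A"
  "one (module.extend A X') = one A" "ring.zero (module.extend A X') = ring.zero A"
  "add (module.extend A X') = add A" "smult (module.extend A X') = smult A"
  by (simp_all add: module.defs)

lemma tensor_null_extend [simp]:
  "tensor_null K (module.extend A X') B' = tensor_null K A B'"
  "tensor_null K A' (module.extend B Y') = tensor_null K A' B"
  by (simp_all add: tensor_null_def tensor_rels_def)

lemma pure_extend [simp]:
  "pure K (module.extend A X') B' = pure K A B'"
  "pure K A' (module.extend B Y') = pure K A' B"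
  by (simp_all add: pure_def fun_eq_iff)

lemma tensor_lift_extend [simp]:
  "tensor_lift K (module.extend A X') B' D f = tensor_lift K A B' D f"
  "tensor_lift K A' (module.extend B Y') D g = tensor_lift K A' B D g"
  by (simp_all add: tensor_lift_def tensor_ext_def fun_eq_iff)

lemma tensor_extend [simp]:
  "tensor K (module.extend A X') B' = tensor K A B'"
  "tensor K A' (module.extend B Y') = tensor K A' B"
  by (simp_all add: tensor_def tensor_group_def tensor_ext_def[abs_def])

lemma quasi_triangular_extend:
  "quasi_triangular K (module.extend A (hopf.fields \<Delta> \<epsilon> \<sigma>)) T \<longleftrightarrow>
     T \<in> Units (tensor K A A) \<and>
     (\<forall>x\<in>carrier A. tensor_flip K A A (\<Delta> x) =
        T \<otimes>\<^bsub>tensor K A A\<^esub> \<Delta> x \<otimes>\<^bsub>tensor K A A\<^esub> inv\<^bsub>tensor K A A\<^esub> T) \<and>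
     tensor_assoc K A A A (tensor_map K A A (tensor K A A) A \<Delta> (\<lambda>y. y) T) =
        leg13 K A A A T \<otimes>\<^bsub>tensor3 K A A A\<^esub> leg23 K A A A T \<and>
     tensor_map K A A A (tensor K A A) (\<lambda>y. y) \<Delta> T =
        leg13 K A A A T \<otimes>\<^bsub>tensor3 K A A A\<^esub> leg12 K A A A T"
proof -
  have "comult (module.extend A (hopf.fields \<Delta> \<epsilon> \<sigma>)) = \<Delta>"
    by (simp add: module.defs hopf.defs)
  then show ?thesis
    by (simp add: quasi_triangular_def tensor_flip_def tensor_assoc_def tensor_map_def
        leg12_def leg13_def leg23_def)
qed

theorem theorem4p1:
  fixes K :: "('k, 'r) ring_scheme"
    and B :: "('k, 'b) hopf" and C :: "('k, 'c) hopf"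
    and R :: "('c \<times> 'b \<Rightarrow>\<^sub>0 int) set"
    and RB :: "('b \<times> 'b \<Rightarrow>\<^sub>0 int) set"
    and RC :: "('c \<times> 'c \<Rightarrow>\<^sub>0 int) set"
  assumes "cring K" and "hopf_algebra K B" and "hopf_algebra K C"
    and "R \<in> Units (tensor K C B)"
    and "tensor_assoc K C C B (tensor_map K C B (tensor K C C) B (comult C) (\<lambda>b. b) R) =
         leg23 K C C B R \<otimes>\<^bsub>tensor3 K C C B\<^esub> leg13 K C C B R"
    and "tensor_map K C B C (tensor K B B) (\<lambda>c. c) (comult B) R =
         leg12 K C B B R \<otimes>\<^bsub>tensor3 K C B B\<^esub> leg13 K C B B R"
    and "tensor_map K C B C B (\<lambda>c. c) (antipode B) R = inv\<^bsub>tensor K C B\<^esub> R"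
    and "tensor_map K C B C B (antipode C) (\<lambda>b. b) R = inv\<^bsub>tensor K C B\<^esub> R"
    and "quasi_triangular K B RB" and "quasi_triangular K C RC"
  shows "quasi_triangular K (twisted_product K B C R)
    (cb41 K B C R \<otimes>\<^bsub>tensor_BCBC K B C\<^esub> bb13 K B C RB
       \<otimes>\<^bsub>tensor_BCBC K B C\<^esub> cc24 K B C RC
       \<otimes>\<^bsub>tensor_BCBC K B C\<^esub> inv\<^bsub>tensor_BCBC K B C\<^esub> (cb23 K B C R))"
proof -
  have B: "nc_algebra K B" and C: "nc_algebra K C"
    using assms(2,3) by (simp_all add: hopf_algebra_def)
  have "alg_hom K B (tensor K B B) (comult B)" "alg_hom K C (tensor K C C) (comult C)"
    using hopf_algebra.comult_ring_hom[OF assms(2)] hopf_algebra.comult_linear[OF assms(2)]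
      hopf_algebra.comult_ring_hom[OF assms(3)] hopf_algebra.comult_linear[OF assms(3)]
    by (auto intro!: alg_hom.intro tensor_algebra.tensor_nc_algebra tensor_algebra.intro B C)
  then interpret twist K B C R RB RC
    using B C assms by (intro twist.intro algebra_pair.intro twist_axioms.intro)
  show ?thesis
    unfolding twisted_product_def quasi_triangular_extend twisted_R_def[symmetric] twisted_comult_def[symmetric]
    by (intro conjI ballI twisted_R_Units twisted_cocommutative twisted_left twisted_right)
qed

end
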